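(* Let $\ell \geqslant 1$ be an integer, and let $G$ be a graph such that the $\ell$-link graph $\mathbb{L}_\ell(G)$ contains at least one edge. Then $\eta(\mathbb{L}_\ell(G)) \geqslant \max\{\eta(G), \mathrm{d}(G)\}$, where $\eta$ denotes the Hadwiger number and $\mathrm{d}(G)$ the degeneracy of $G$.
   Context: All graphs are finite, undirected and loopless; parallel edges are allowed. For an integer $\ell \geqslant 0$, an $\ell$-arc of $G$ is an alternating sequence $\vec{L} = (v_0, e_1, v_1, \ldots, e_\ell, v_\ell)$ of vertices and edges of $G$ such that $e_i$ has end vertices $v_{i-1}, v_i$ for $1 \leqslant i \leqslant \ell$, and $e_i \neq e_{i+1}$ for $1 \leqslant i \leqslant \ell - 1$ (vertices and non-consecutive edges may repeat). An $\ell$-link is an $\ell$-arc identified with its reverse sequence, written $L = [v_0, e_1, \ldots, e_\ell, v_\ell]$. For an $\ell$-arc $\vec{L}$ and $0 \leqslant i \leqslant j \leqslant \ell$, $\vec{L}[i,j]$ is the $(j-i)$-link $[v_i, e_{i+1}, \ldots, e_j, v_j]$. The $\ell$-link graph $\mathbb{L}_\ell(G)$ has as vertices the $\ell$-links of $G$, and the number of edges between two $\ell$-links $L, R$ is the number of $(\ell+1)$-links $Q$ of $G$ such that $\{\vec{Q}[0,\ell], \vec{Q}[1,\ell+1]\} = \{L, R\}$ ($\vec Q$ being either of the two $(\ell+1)$-arcs representing $Q$; the two $\ell$-links $\vec{Q}[0,\ell]$ and $\vec{Q}[1,\ell+1]$ are always distinct, so $\mathbb{L}_\ell(G)$ is loopless).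 Contracting an edge means identifying its end vertices and deleting resulting loops; $H$ is a minor of $G$ if $H$ can be obtained from a subgraph of $G$ by contracting edges. The Hadwiger number $\eta(G)$ is the maximum integer $t$ such that $G$ has a minor isomorphic to the complete graph $K_t$. The degeneracy $\mathrm{d}(G)$ is the maximum, over subgraphs $H$ of $G$, of the minimum degree $\delta(H)$ (degrees count parallel edges with multiplicity). *)

theory Defs
  imports Main
begin

text \<open>Multigraphs carry a type of edge names, so that parallel edges are distinct edges with the
  same set of ends.\<close>

record ('v, 'e) mgraph =
  verts :: "'v set"
  edges :: "'e set"
  ends :: "'e \<Rightarrow> 'v set"

definition multigraph :: "('v, 'e) mgraph \<Rightarrow> bool" where
  "multigraph G \<longleftrightarrow> finite (verts G) \<and> finite (edges G) \<and>
     (\<forall>e\<in>edges G. ends G e \<subseteq> verts G \<and> card (ends G e) = 2)"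

definition subgraph :: "('v, 'e) mgraph \<Rightarrow> ('v, 'e) mgraph \<Rightarrow> bool" where
  "subgraph H G \<longleftrightarrow> multigraph H \<and> verts H \<subseteq> verts G \<and> edges H \<subseteq> edges G \<and>
     (\<forall>e\<in>edges H. ends H e = ends G e)"

definition mgraph_iso :: "('v, 'e) mgraph \<Rightarrow> ('w, 'f) mgraph \<Rightarrow> bool" where
  "mgraph_iso G H \<longleftrightarrow> (\<exists>\<phi> \<psi>. bij_betw \<phi> (verts G) (verts H) \<and> bij_betw \<psi> (edges G) (edges H) \<and>
     (\<forall>e\<in>edges G. ends H (\<psi> e) = \<phi> ` ends G e))"

definition complete_mgraph :: "nat \<Rightarrow> (nat, nat set) mgraph" where
  "complete_mgraph t =
     \<lparr> verts = {..<t}, edges = {e. e \<subseteq> {..<t} \<and> card e = 2}, ends = (\<lambda>e. e) \<rparr>"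


subsection \<open>Minors and the Hadwiger number\<close>

text \<open>The vertex \<open>v\<close> is identified with \<open>u\<close>, whose name is kept. The edges deleted as loops are
  exactly those joining \<open>u\<close> and \<open>v\<close>, including the ones parallel to the contracted edge.\<close>

definition identify :: "'v \<Rightarrow> 'v \<Rightarrow> ('v, 'e) mgraph \<Rightarrow> ('v, 'e) mgraph" where
  "identify u v G =
     \<lparr> verts = verts G - {v},
       edges = {f \<in> edges G. ends G f \<noteq> {u, v}},
       ends = (\<lambda>f. (\<lambda>x. if x = v then u else x) ` ends G f) \<rparr>"

definition edge_contraction :: "('v, 'e) mgraph \<Rightarrow> ('v, 'e) mgraph \<Rightarrow> bool" where
  "edge_contraction G H \<longleftrightarrow> (\<exists>e\<in>edges G. \<exists>u v. ends G e = {u, v} \<and> H = identify u v G)"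

definition has_minor :: "('v, 'e) mgraph \<Rightarrow> ('w, 'f) mgraph \<Rightarrow> bool" where
  "has_minor G H \<longleftrightarrow> (\<exists>S M. subgraph S G \<and> edge_contraction\<^sup>*\<^sup>* S M \<and> mgraph_iso M H)"

definition hadwiger :: "('v, 'e) mgraph \<Rightarrow> nat" where
  "hadwiger G = Max {t. has_minor G (complete_mgraph t)}"


subsection \<open>Degeneracy\<close>

definition degree :: "('v, 'e) mgraph \<Rightarrow> 'v \<Rightarrow> nat" where
  "degree G v = card {e \<in> edges G. v \<in> ends G e}"

definition min_degree :: "('v, 'e) mgraph \<Rightarrow> nat" where
  "min_degree G = Min (degree G ` verts G)"

definition degeneracy :: "('v, 'e) mgraph \<Rightarrow> nat" where
  "degeneracy G = Max {min_degree H | H. subgraph H G \<and> verts H \<noteq> {}}"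


subsection \<open>Links and link graphs\<close>

text \<open>The sequence \<open>(v\<^sub>0, e\<^sub>1, v\<^sub>1, \<dots>, e\<^sub>l, v\<^sub>l)\<close> is stored as its list of vertices and
  its list of edges. Lists are indexed from 0, so \<open>e\<^sub>i\<close> is entry \<open>i - 1\<close> of the second list.\<close>

type_synonym ('v, 'e) arc = "'v list \<times> 'e list"

definition is_arc :: "('v, 'e) mgraph \<Rightarrow> nat \<Rightarrow> ('v, 'e) arc \<Rightarrow> bool" where
  "is_arc G l a \<longleftrightarrow> (case a of (vs, es) \<Rightarrow>
     length vs = l + 1 \<and> length es = l \<and> set vs \<subseteq> verts G \<and> set es \<subseteq> edges G \<and>
     (\<forall>i<l. ends G (es ! i) = {vs ! i, vs ! (i + 1)}) \<and>
     (\<forall>i. i + 1 < l \<longrightarrow> es ! i \<noteq> es ! (i + 1)))"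

definition rev_arc :: "('v, 'e) arc \<Rightarrow> ('v, 'e) arc" where
  "rev_arc a = (rev (fst a), rev (snd a))"

definition link_of :: "('v, 'e) arc \<Rightarrow> ('v, 'e) arc set" where
  "link_of a = {a, rev_arc a}"

definition links :: "('v, 'e) mgraph \<Rightarrow> nat \<Rightarrow> ('v, 'e) arc set set" where
  "links G l = link_of ` {a. is_arc G l a}"

text \<open>The segment from \<open>v\<^sub>i\<close> to \<open>v\<^sub>j\<close>, as an arc.\<close>

definition segment :: "('v, 'e) arc \<Rightarrow> nat \<Rightarrow> nat \<Rightarrow> ('v, 'e) arc" where
  "segment a i j = (drop i (take (j + 1) (fst a)), drop i (take j (snd a)))"

text \<open>In \<open>link_graph\<close> the union ranges over the two arcs representing the link \<open>Q\<close>; both contribute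
  the same pair of links, see \<open>ends_link_graph\<close> below.\<close>

definition link_graph :: "nat \<Rightarrow> ('v, 'e) mgraph \<Rightarrow> (('v, 'e) arc set, ('v, 'e) arc set) mgraph" where
  "link_graph l G =
     \<lparr> verts = links G l,
       edges = links G (l + 1),
       ends = (\<lambda>Q. \<Union>a\<in>Q. {link_of (segment a 0 l), link_of (segment a 1 (l + 1))}) \<rparr>"


subsection \<open>Well-definedness\<close>

lemma rev_arc_rev_arc [simp]: "rev_arc (rev_arc a) = a"
  by (simp add: rev_arc_def)

lemma link_of_rev_arc [simp]: "link_of (rev_arc a) = link_of a"
  by (auto simp: link_of_def)

lemma link_of_eq_iff: "link_of a = link_of b \<longleftrightarrow> a = b \<or> a = rev_arc b"
  by (auto simp: link_of_def doubleton_eq_iff)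

lemma is_arc_rev_arc:
  assumes "is_arc G l a"
  shows "is_arc G l (rev_arc a)"
proof -
  obtain vs es where a: "a = (vs, es)" by force
  have len: "length vs = l + 1" "length es = l"
    and en: "\<And>i. i < l \<Longrightarrow> ends G (es ! i) = {vs ! i, vs ! (i + 1)}"
    and ne: "\<And>i. i + 1 < l \<Longrightarrow> es ! i \<noteq> es ! (i + 1)"
    using assms by (auto simp: a is_arc_def)
  have "ends G (rev es ! i) = {rev vs ! i, rev vs ! (i + 1)}" if "i < l" for i
    using that en[of "l - Suc i"] len by (auto simp: rev_nth Suc_diff_Suc)
  moreover have "rev es ! i \<noteq> rev es ! (i + 1)" if "i + 1 < l" for i
  proof -
    have "Suc (l - Suc (Suc i)) = l - Suc i" using that by simp
    then show ?thesis using that ne[of "l - Suc (Suc i)"] len by (auto simp: rev_nth)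
  qed
  ultimately show ?thesis
    using assms by (auto simp: a is_arc_def rev_arc_def)
qed

lemma is_arc_segment:
  assumes "is_arc G l a" "i \<le> j" "j \<le> l"
  shows "is_arc G (j - i) (segment a i j)"
proof -
  obtain vs es where a: "a = (vs, es)" by force
  have "set (drop i (take (j + 1) vs)) \<subseteq> set vs" "set (drop i (take j es)) \<subseteq> set es"
    by (meson order_trans set_drop_subset set_take_subset)+
  then show ?thesis
    using assms by (fastforce simp: a is_arc_def segment_def)
qed

lemma segment_rev_arc:
  assumes "is_arc G l a" "i \<le> j" "j \<le> l"
  shows "segment (rev_arc a) i j = rev_arc (segment a (l - j) (l - i))"
proof -
  obtain vs es where a: "a = (vs, es)" by force
  have "length vs = l + 1" "length es = l"
    using assms(1) by (auto simp: a is_arc_def)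
  then show ?thesis
    using assms(2,3)
    by (auto simp: a segment_def rev_arc_def rev_nth intro!: nth_equalityI arg_cong[of _ _ "(!) _"])
qed

lemma ends_link_graph:
  assumes "is_arc G (l + 1) a"
  shows "ends (link_graph l G) (link_of a)
    = {link_of (segment a 0 l), link_of (segment a 1 (l + 1))}"
  using segment_rev_arc[OF assms, of 0 l] segment_rev_arc[OF assms, of 1 "l + 1"]
  by (auto simp: link_graph_def link_of_def[of a])

lemma link_ends_distinct:
  assumes "multigraph G" "is_arc G (l + 1) a"
  shows "link_of (segment a 0 l) \<noteq> link_of (segment a 1 (l + 1))"
proof
  assume eq: "link_of (segment a 0 l) = link_of (segment a 1 (l + 1))"
  obtain vs es where a: "a = (vs, es)" by force
  have len: "length vs = l + 2" "length es = l + 1"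
    and en: "\<And>i. i < l + 1 \<Longrightarrow> ends G (es ! i) = {vs ! i, vs ! (i + 1)}"
    and ne: "\<And>i. i < l \<Longrightarrow> es ! i \<noteq> es ! (i + 1)"
    and se: "\<And>i. i < l + 1 \<Longrightarrow> es ! i \<in> edges G"
    using assms(2) by (auto simp: a is_arc_def)
  have nl: "vs ! i \<noteq> vs ! (i + 1)" if "i < l + 1" for i
    using assms(1) se[OF that] en[OF that] by (auto simp: multigraph_def)
  show False
  proof (cases "segment a 0 l = segment a 1 (l + 1)")
    case True
    then have v: "take (l + 1) vs = drop 1 vs" and e: "take l es = drop 1 es"
      using len by (auto simp: a segment_def)
    show False
      using nl[of 0] arg_cong[OF v, of "\<lambda>xs. xs ! 0"] len by simp
  next
    case False
    then have "segment a 0 l = rev_arc (segment a 1 (l + 1))"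
      using eq by (simp add: link_of_eq_iff)
    then have v: "take (l + 1) vs = rev (drop 1 vs)" and e: "take l es = rev (drop 1 es)"
      using len by (auto simp: a segment_def rev_arc_def)
    have vi: "vs ! i = vs ! (l + 1 - i)" if "i < l + 1" for i
      using arg_cong[OF v, of "\<lambda>xs. xs ! i"] that len by (simp add: rev_nth Suc_diff_le)
    have ei: "es ! i = es ! (l - i)" if "i < l" for i
      using arg_cong[OF e, of "\<lambda>xs. xs ! i"] that len by (simp add: rev_nth Suc_diff_Suc)
    show False
    proof (cases "even l")
      case True
      then obtain k where "l = 2 * k" by blast
      then show False using vi[of k] nl[of k] by simp
    next
      case False
      then obtain k where "l = 2 * k + 1" by (blast elim: oddE)
      then show False using ei[of k] ne[of k] by simp
    qed
  qed
qed

lemma finite_links: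
  assumes "multigraph G"
  shows "finite (links G l)"
proof -
  have "{a. is_arc G l a} \<subseteq> {vs. set vs \<subseteq> verts G \<and> length vs = l + 1}
      \<times> {es. set es \<subseteq> edges G \<and> length es = l}"
    by (auto simp: is_arc_def)
  moreover have "finite \<dots>"
    using assms by (intro finite_cartesian_product finite_lists_length_eq) (auto simp: multigraph_def)
  ultimately show ?thesis
    unfolding links_def by (blast intro: finite_subset)
qed

lemma multigraph_link_graph:
  assumes "multigraph G"
  shows "multigraph (link_graph l G)"
proof -
  have "ends (link_graph l G) (link_of a) \<subseteq> links G l \<and> card (ends (link_graph l G) (link_of a)) = 2"
    if a: "is_arc G (l + 1) a" for a
    using link_ends_distinct[OF assms a] is_arc_segment[OF a, of 0 l] is_arc_segment[OF a, of 1 "l + 1"]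
    by (auto simp: ends_link_graph[OF a] links_def)
  then have "\<forall>Q\<in>links G (l + 1). ends (link_graph l G) Q \<subseteq> links G l \<and> card (ends (link_graph l G) Q) = 2"
    unfolding links_def[of G "l + 1"] by blast
  moreover have "verts (link_graph l G) = links G l" "edges (link_graph l G) = links G (l + 1)"
    by (simp_all add: link_graph_def)
  ultimately show ?thesis
    using finite_links[OF assms] by (simp add: multigraph_def)
qed

lemma edge_contractions_card_verts:
  assumes "edge_contraction\<^sup>*\<^sup>* S M" "finite (verts S)"
  shows "finite (verts M) \<and> card (verts M) \<le> card (verts S)"
  using assms
proof (induction rule: rtranclp_induct)
  case (step M N)
  then obtain v where "verts N = verts M - {v}"
    by (auto simp: edge_contraction_def identify_def)
  then show ?case
    using step by (metis card_Diff1_le finite_Diff le_trans)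
qed simp

lemma hadwiger_set:
  assumes "multigraph G"
  shows "finite {t. has_minor G (complete_mgraph t)}" 
    and "{t. has_minor G (complete_mgraph t)} \<noteq> {}"
proof -
  let ?T = "{t. has_minor G (complete_mgraph t)}"
  have "t \<le> card (verts G)" if minor: "has_minor G (complete_mgraph t)" for t
  proof -
    obtain S M where S: "subgraph S G" and M: "edge_contraction\<^sup>*\<^sup>* S M"
      and iso: "mgraph_iso M (complete_mgraph t)"
      using minor by (auto simp: has_minor_def)
    have "card (verts M) = t"
      using iso by (auto simp: mgraph_iso_def complete_mgraph_def dest: bij_betw_same_card)
    moreover have "finite (verts S)" "card (verts S) \<le> card (verts G)"
      using S assms by (auto simp: subgraph_def multigraph_def intro: card_mono)
    ultimately show ?thesis
      using edge_contractions_card_verts[OF M] by simp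
  qed
  then have "?T \<subseteq> {..card (verts G)}" by auto
  then show "finite ?T" by (rule finite_subset) simp
  let ?S = "\<lparr> verts = {}, edges = {}, ends = ends G \<rparr>"
  have "subgraph ?S G"
    by (simp add: subgraph_def multigraph_def)
  moreover have "mgraph_iso ?S (complete_mgraph 0)"
    by (auto simp: mgraph_iso_def complete_mgraph_def bij_betw_def)
  ultimately have "has_minor G (complete_mgraph 0)"
    unfolding has_minor_def by blast
  then show "?T \<noteq> {}" by blast
qed

lemma degeneracy_set:
  assumes "multigraph G"
  shows "finite {min_degree H | H. subgraph H G \<and> verts H \<noteq> {}}"
    and "verts G \<noteq> {} \<Longrightarrow> {min_degree H | H. subgraph H G \<and> verts H \<noteq> {}} \<noteq> {}"
proof -
  let ?D = "{min_degree H | H. subgraph H G \<and> verts H \<noteq> {}}"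
  have "min_degree H \<le> card (edges G)" if H: "subgraph H G" and ne: "verts H \<noteq> {}" for H
  proof -
    obtain v where v: "v \<in> verts H" using ne by blast
    have "min_degree H \<le> degree H v"
      using H v by (auto simp: min_degree_def subgraph_def multigraph_def)
    also have "\<dots> \<le> card (edges G)"
      using H assms unfolding degree_def
      by (intro card_mono) (auto simp: subgraph_def multigraph_def)
    finally show ?thesis .
  qed
  then have "?D \<subseteq> {..card (edges G)}" by auto
  then show "finite ?D" by (rule finite_subset) simp
  show "?D \<noteq> {}" if "verts G \<noteq> {}"
    using assms that by (auto simp: subgraph_def)
qed

end

theory Submission
  imports Defs
begin

text \<open>A clique minor is the same as a system of branch sets: disjoint connected vertex sets, any two of
  which are joined by an edge (\<open>has_minor_imp_clique_model\<close>, \<open>clique_model_imp_has_minor\<close>). So the task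
  is to find such systems in the link graph, whose vertices are best thought of as snakes of length
  \<open>l\<close> that crawl in \<open>G\<close> without turning back on the spot; adjacency is one step of a snake.

  For the degeneracy \<open>d\<close>, take a snake of length \<open>l - 1\<close> in a subgraph of minimum degree \<open>d\<close>. Its at least
  \<open>d - 1\<close> extensions at the front are adjacent to its at least \<open>d - 1\<close> extensions at the back, and a
  complete bipartite graph with sides of size \<open>d - 1\<close> contracts to a clique on \<open>d\<close> vertices
  (\<open>min_degree_clique_model\<close>).

  Now let \<open>G\<close> have a system of \<open>t\<close> branch sets. An edge of the link graph settles \<open>t \<le> 2\<close>. For \<open>t \<ge> 3\<close> all
  vertices with fewer than two edges can be removed from the system, so that every snake can always
  crawl on (\<open>clique_model_branching\<close>). New branch sets are described by a label on snakes together with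
  tracks on which the label changes just once (\<open>clique_model_of_slides\<close>).

  If every branch set \<open>B i\<close> contains two vertices at distance at least \<open>l\<close>, label a snake by the branch
  set of its middle. In \<open>B i\<close> there is a walk of length \<open>l\<close>. A snake that enters \<open>B i\<close> crawls to this
  walk and turns into the direction with more room; then it can move onto the walk without its middle
  ever leaving \<open>B i\<close> (\<open>approach_walk\<close>, \<open>large_branch_sets\<close>).

  If some branch set \<open>X\<close> has diameter less than \<open>l\<close>, choose an edge \<open>f j\<close> from \<open>X\<close> to each of the other
  \<open>t - 1\<close> branch sets, and label a snake by the edge \<open>f j\<close> that it contains. Pulling a snake through \<open>X\<close>
  from \<open>f j\<close> to \<open>f k\<close> shows that these labels give a clique of size \<open>t - 1\<close>. If \<open>t \<ge> 4\<close>, the other branch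
  sets still form a system of at least three, in which there is room for a snake that avoids \<open>X\<close>
  altogether. All snakes of the first kind can crawl there, which provides the last branch set
  (\<open>small_branch_set\<close>). If \<open>t = 3\<close>, there may be no such room; but then a snake running round a cycle through
  the three branch sets, again labelled by its middle, suffices (\<open>three_branch_sets\<close>).\<close>


section \<open>Branch sets\<close>

definition adjacent_in :: "('v, 'e) mgraph \<Rightarrow> 'v set \<Rightarrow> 'v \<Rightarrow> 'v \<Rightarrow> bool" where
  "adjacent_in G B x y \<longleftrightarrow> x \<in> B \<and> y \<in> B \<and> (\<exists>e\<in>edges G. ends G e = {x, y})"

definition connected_in :: "('v, 'e) mgraph \<Rightarrow> 'v set \<Rightarrow> bool" where
  "connected_in G B \<longleftrightarrow> (\<forall>x\<in>B. \<forall>y\<in>B. (adjacent_in G B)\<^sup>*\<^sup>* x y)"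

definition clique_model :: "('v, 'e) mgraph \<Rightarrow> 'i set \<Rightarrow> ('i \<Rightarrow> 'v set) \<Rightarrow> bool" where
  "clique_model G I B \<longleftrightarrow>
     (\<forall>i\<in>I. B i \<noteq> {} \<and> B i \<subseteq> verts G \<and> connected_in G (B i)) \<and>
     (\<forall>i\<in>I. \<forall>j\<in>I. i \<noteq> j \<longrightarrow> B i \<inter> B j = {} \<and>
        (\<exists>e\<in>edges G. \<exists>x\<in>B i. \<exists>y\<in>B j. ends G e = {x, y}))"

lemma adjacent_in_sym: "adjacent_in G B x y \<Longrightarrow> adjacent_in G B y x"
  unfolding adjacent_in_def by (metis insert_commute)

lemma adjacent_in_rtranclp_sym:
  assumes "(adjacent_in G B)\<^sup>*\<^sup>* x y"
  shows "(adjacent_in G B)\<^sup>*\<^sup>* y x"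
proof -
  have "symp (adjacent_in G B)" by (rule sympI) (rule adjacent_in_sym)
  then show ?thesis using assms by (rule symp_rtranclp[THEN sympD])
qed

lemma adjacent_in_rtranclp_mono:
  assumes "(adjacent_in G B)\<^sup>*\<^sup>* x y" "B \<subseteq> C"
  shows "(adjacent_in G C)\<^sup>*\<^sup>* x y"
proof -
  have "adjacent_in G B \<le> adjacent_in G C"
    using assms(2) by (auto simp: adjacent_in_def)
  then show ?thesis using assms(1) by (meson rtranclp_mono predicate2D)
qed

lemma connected_in_Un:
  assumes "connected_in G B" "connected_in G C" "x \<in> B" "y \<in> C"
    and "e \<in> edges G" "ends G e = {x, y}"
  shows "connected_in G (B \<union> C)"
proof -
  have xy: "adjacent_in G (B \<union> C) x y"
    using assms by (auto simp: adjacent_in_def)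
  have "(adjacent_in G (B \<union> C))\<^sup>*\<^sup>* x z" if "z \<in> B \<union> C" for z
  proof (cases "z \<in> B")
    case True
    then show ?thesis
      using assms(1,3) adjacent_in_rtranclp_mono[of G B x z "B \<union> C"] by (auto simp: connected_in_def)
  next
    case False
    then have "(adjacent_in G (B \<union> C))\<^sup>*\<^sup>* y z"
      using assms(2,4) that adjacent_in_rtranclp_mono[of G C y z "B \<union> C"] by (auto simp: connected_in_def)
    then show ?thesis using xy by (rule converse_rtranclp_into_rtranclp[rotated])
  qed
  then show ?thesis
    unfolding connected_in_def by (meson adjacent_in_rtranclp_sym rtranclp_trans)
qed

lemma clique_model_mono:
  assumes "clique_model G I B" "J \<subseteq> I"
  shows "clique_model G J B"
  using assms by (auto simp: clique_model_def subset_iff)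

lemma clique_model_disjoint:
  assumes "clique_model G I B" "i \<in> I" "j \<in> I" "x \<in> B i" "x \<in> B j"
  shows "i = j"
proof (rule ccontr)
  assume "i \<noteq> j"
  then have "B i \<inter> B j = {}" using assms(1-3) by (simp add: clique_model_def)
  then show False using assms(4,5) by auto
qed

lemma clique_model_touch:
  assumes "clique_model G I B" "i \<in> I" "j \<in> I" "i \<noteq> j"
  obtains e x y where "e \<in> edges G" "x \<in> B i" "y \<in> B j" "ends G e = {x, y}"
  using assms unfolding clique_model_def by (metis (no_types, lifting))

lemma clique_model_index:
  assumes "clique_model G {..<t} B"
  obtains idx :: "'v \<Rightarrow> nat" where "\<And>i v. i < t \<Longrightarrow> v \<in> B i \<Longrightarrow> idx v = i"
proof (rule that[of "\<lambda>v. THE i. i < t \<and> v \<in> B i"])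
  fix i v assume iv: "i < t" "v \<in> B i"
  show "(THE i. i < t \<and> v \<in> B i) = i"
    by (rule the_equality) (use iv clique_model_disjoint[OF assms] in auto)
qed

lemma multigraph_identify:
  assumes "multigraph G" "u \<noteq> v" "u \<in> verts G"
  shows "multigraph (identify u v G)"
proof -
  let ?r = "\<lambda>x. if x = v then u else x"
  have "?r ` ends G f \<subseteq> verts G - {v} \<and> card (?r ` ends G f) = 2"
    if "f \<in> edges G" "ends G f \<noteq> {u, v}" for f
  proof -
    have "ends G f \<subseteq> verts G" "card (ends G f) = 2"
      using assms(1) that by (auto simp: multigraph_def)
    then obtain x y where "ends G f = {x, y}" "x \<noteq> y"
      by (auto simp: card_2_iff)
    then have "x \<in> verts G" "y \<in> verts G" "{x, y} \<noteq> {u, v}" "{x, y} \<noteq> {v, u}"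
      using \<open>ends G f \<subseteq> verts G\<close> that(2) by (simp_all add: insert_commute)
    then have "?r x \<in> verts G - {v}" "?r y \<in> verts G - {v}" "?r x \<noteq> ?r y"
      using \<open>x \<noteq> y\<close> assms(2,3) by simp_all metis
    then show ?thesis
      unfolding \<open>ends G f = {x, y}\<close> image_insert image_empty by (simp del: if_split)
  qed
  then show ?thesis
    using assms(1) by (auto simp: multigraph_def identify_def)
qed

text \<open>Contractions only ever merge vertices, so the vertices of the result are the fibres of a map
  from the vertices of the start. Looplessness is carried along because contracting a loop would
  delete its vertex.\<close>

lemma edge_contractions_fibres:
  assumes "edge_contraction\<^sup>*\<^sup>* S M" "multigraph S"
  shows "multigraph M \<and> (\<exists>\<phi>.
    (\<forall>x\<in>verts M. {y\<in>verts S. \<phi> y = x} \<noteq> {} \<and> connected_in S {y\<in>verts S. \<phi> y = x}) \<and>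
    (\<forall>f\<in>edges M. f \<in> edges S \<and> ends M f = \<phi> ` ends S f))"
  using assms
proof (induction rule: rtranclp_induct)
  case base
  have "{y \<in> verts S. y = x} = {x}" if "x \<in> verts S" for x
    using that by auto
  then show ?case
    using base by (auto intro!: exI[of _ "\<lambda>x. x"] simp: connected_in_def)
next
  case (step M N)
  then obtain \<phi> where M: "multigraph M"
    and fib: "\<And>x. x \<in> verts M \<Longrightarrow> {y\<in>verts S. \<phi> y = x} \<noteq> {}"
      "\<And>x. x \<in> verts M \<Longrightarrow> connected_in S {y\<in>verts S. \<phi> y = x}"
    and en: "\<And>f. f \<in> edges M \<Longrightarrow> f \<in> edges S" "\<And>f. f \<in> edges M \<Longrightarrow> ends M f = \<phi> ` ends S f"
    by blast
  obtain e u v where e: "e \<in> edges M" "ends M e = {u, v}" and N: "N = identify u v M"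
    using step.hyps(2) by (auto simp: edge_contraction_def)
  have uv: "u \<in> verts M" "v \<in> verts M" "u \<noteq> v"
    using M e by (auto simp: multigraph_def)
  define \<phi>' where "\<phi>' = (\<lambda>x. if \<phi> x = v then u else \<phi> x)"
  have "{y\<in>verts S. \<phi>' y = x} \<noteq> {} \<and> connected_in S {y\<in>verts S. \<phi>' y = x}"
    if x: "x \<in> verts N" for x
  proof (cases "x = u")
    case False
    then have "{y\<in>verts S. \<phi>' y = x} = {y\<in>verts S. \<phi> y = x}"
      using x by (auto simp: \<phi>'_def N identify_def)
    then show ?thesis
      using fib[of x] x by (auto simp: N identify_def)
  next
    case True
    have eq: "{y\<in>verts S. \<phi>' y = x} = {y\<in>verts S. \<phi> y = u} \<union> {y\<in>verts S. \<phi> y = v}"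
      using True uv by (auto simp: \<phi>'_def)
    have "card (ends S e) = 2" "ends S e \<subseteq> verts S"
      using step.prems en(1)[OF e(1)] by (auto simp: multigraph_def)
    then obtain a b where ab: "ends S e = {a, b}" "a \<in> verts S" "b \<in> verts S"
      by (auto simp: card_2_iff)
    have "{\<phi> a, \<phi> b} = {u, v}"
      using en(2)[OF e(1)] e(2) ab by simp
    then obtain a' b' where "ends S e = {a', b'}" "a' \<in> {y\<in>verts S. \<phi> y = u}" "b' \<in> {y\<in>verts S. \<phi> y = v}"
      using ab by (fastforce simp: doubleton_eq_iff)
    then show ?thesis
      using connected_in_Un[OF fib(2)[OF uv(1)] fib(2)[OF uv(2)]] en(1)[OF e(1)] fib(1)[OF uv(1)]
      unfolding eq by blast
  qed
  moreover have "f \<in> edges S \<and> ends N f = \<phi>' ` ends S f" if "f \<in> edges N" for f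
    using en that by (auto simp: N identify_def \<phi>'_def image_image)
  ultimately show ?case
    using multigraph_identify[OF M uv(3,1)] N by blast
qed

lemma has_minor_imp_clique_model:
  assumes "has_minor G (complete_mgraph t)"
  shows "\<exists>B. clique_model G {..<t} B"
proof -
  obtain S M where S: "subgraph S G" and M: "edge_contraction\<^sup>*\<^sup>* S M"
    and iso: "mgraph_iso M (complete_mgraph t)"
    using assms by (auto simp: has_minor_def)
  have mS: "multigraph S" using S by (simp add: subgraph_def)
  obtain \<phi> where
    fib: "\<And>x. x \<in> verts M \<Longrightarrow> {y\<in>verts S. \<phi> y = x} \<noteq> {} \<and> connected_in S {y\<in>verts S. \<phi> y = x}"
    and en: "\<And>f. f \<in> edges M \<Longrightarrow> f \<in> edges S \<and> ends M f = \<phi> ` ends S f" and mM: "multigraph M"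
    using edge_contractions_fibres[OF M mS] by blast
  obtain \<alpha> \<psi> where \<alpha>: "bij_betw \<alpha> (verts M) {..<t}"
    and \<psi>: "bij_betw \<psi> (edges M) {e. e \<subseteq> {..<t} \<and> card e = 2}"
    and \<alpha>\<psi>: "\<And>e. e \<in> edges M \<Longrightarrow> \<psi> e = \<alpha> ` ends M e"
    using iso by (auto simp: mgraph_iso_def complete_mgraph_def)
  define B where "B i = {y\<in>verts S. \<phi> y \<in> verts M \<and> \<alpha> (\<phi> y) = i}" for i
  have B: "B (\<alpha> x) = {y\<in>verts S. \<phi> y = x}" if "x \<in> verts M" for x
    using that \<alpha> by (auto simp: B_def bij_betw_def inj_on_def)
  have conn: "connected_in G C" if "connected_in S C" for C
  proof -
    have "adjacent_in S C \<le> adjacent_in G C"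
      using S unfolding adjacent_in_def subgraph_def by (intro predicate2I) (metis subsetD)
    then have "(adjacent_in G C)\<^sup>*\<^sup>* x y" if "(adjacent_in S C)\<^sup>*\<^sup>* x y" for x y
      using that by (meson rtranclp_mono predicate2D)
    then show ?thesis using that by (simp add: connected_in_def)
  qed
  have "B i \<noteq> {} \<and> B i \<subseteq> verts G \<and> connected_in G (B i)" if "i < t" for i
  proof -
    obtain x where x: "x \<in> verts M" "i = \<alpha> x"
      using \<alpha> \<open>i < t\<close> by (auto simp: bij_betw_def image_iff dest!: equalityD2 subsetD)
    then show ?thesis
      using fib[OF x(1)] B[OF x(1)] conn S by (auto simp: subgraph_def)
  qed
  moreover have "B i \<inter> B j = {} \<and> (\<exists>e\<in>edges G. \<exists>x\<in>B i. \<exists>y\<in>B j. ends G e = {x, y})"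
    if "i < t" "j < t" "i \<noteq> j" for i j
  proof
    show "B i \<inter> B j = {}" using that by (auto simp: B_def)
    have "{i, j} \<in> {e. e \<subseteq> {..<t} \<and> card e = 2}" using that by auto
    then obtain e where e: "e \<in> edges M" "\<psi> e = {i, j}"
      using \<psi> unfolding bij_betw_def by (metis (no_types, lifting) imageE)
    have eS: "e \<in> edges S" and eM: "ends M e = \<phi> ` ends S e" using en e by auto
    have "card (ends S e) = 2" "ends S e \<subseteq> verts S"
      using mS eS by (auto simp: multigraph_def)
    then obtain a b where ab: "ends S e = {a, b}" "a \<in> verts S" "b \<in> verts S"
      by (auto simp: card_2_iff)
    have ij: "{i, j} = {\<alpha> (\<phi> a), \<alpha> (\<phi> b)}"
      using \<alpha>\<psi>[OF e(1)] e(2) eM ab by simp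
    have "\<phi> a \<in> verts M" "\<phi> b \<in> verts M"
      using mM e(1) eM ab by (auto simp: multigraph_def)
    then have "(a \<in> B i \<and> b \<in> B j) \<or> (a \<in> B j \<and> b \<in> B i)"
      using ij ab by (auto simp: B_def doubleton_eq_iff)
    moreover have "e \<in> edges G" "ends G e = {a, b}" using S eS ab by (auto simp: subgraph_def)
    ultimately show "\<exists>e\<in>edges G. \<exists>x\<in>B i. \<exists>y\<in>B j. ends G e = {x, y}"
      by (metis insert_commute)
  qed
  ultimately show ?thesis
    unfolding clique_model_def by (intro exI[of _ B]) auto
qed

text \<open>As a contraction deletes only the edges parallel to the contracted one, two different fibres
  must be joined by a single edge if the result is to be a complete graph without parallel edges.\<close>

lemma contract_fibres:
  assumes "multigraph S" "idx ` verts S = {..<t}"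
    and "\<And>i. i < t \<Longrightarrow> connected_in S {x\<in>verts S. idx x = i}"
    and "\<And>i j. i < t \<Longrightarrow> j < t \<Longrightarrow> i \<noteq> j \<Longrightarrow> \<exists>!e. e \<in> edges S \<and> idx ` ends S e = {i, j}"
  shows "\<exists>M. edge_contraction\<^sup>*\<^sup>* S M \<and> mgraph_iso M (complete_mgraph t)"
  using assms
proof (induction "card (verts S)" arbitrary: S rule: less_induct)
  case less
  show ?case
  proof (cases "inj_on idx (verts S)")
    case True
    let ?\<psi> = "\<lambda>e. idx ` ends S e"
    have im: "idx ` ends S e \<subseteq> {..<t} \<and> card (idx ` ends S e) = 2" if "e \<in> edges S" for e
    proof -
      have "ends S e \<subseteq> verts S" "card (ends S e) = 2"
        using less.prems(1) that by (auto simp: multigraph_def)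
      then show ?thesis
        using less.prems(2) card_image[OF inj_on_subset[OF True]] by force
    qed
    have "inj_on ?\<psi> (edges S)"
    proof (rule inj_onI)
      fix e f assume ef: "e \<in> edges S" "f \<in> edges S" "?\<psi> e = ?\<psi> f"
      obtain i j where "?\<psi> e = {i, j}" "i \<noteq> j"
        using im[OF ef(1)] by (auto simp: card_2_iff)
      moreover have "{i, j} \<subseteq> {..<t}" using calculation im[OF ef(1)] by simp
      ultimately show "e = f"
        using less.prems(4)[of i j] ef by (metis insert_subset lessThan_iff)
    qed
    moreover have "?\<psi> ` edges S = {e. e \<subseteq> {..<t} \<and> card e = 2}"
    proof
      show "?\<psi> ` edges S \<subseteq> {e. e \<subseteq> {..<t} \<and> card e = 2}" using im by blast
      show "{e. e \<subseteq> {..<t} \<and> card e = 2} \<subseteq> ?\<psi> ` edges S"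
      proof
        fix c assume "c \<in> {e. e \<subseteq> {..<t} \<and> card e = 2}"
        then obtain i j where "c = {i, j}" "i \<noteq> j" "i < t" "j < t" by (auto simp: card_2_iff)
        then show "c \<in> ?\<psi> ` edges S" using less.prems(4)[of i j] by (metis imageI)
      qed
    qed
    ultimately have "mgraph_iso S (complete_mgraph t)"
      using True less.prems(2) unfolding mgraph_iso_def complete_mgraph_def bij_betw_def
      by (intro exI[of _ idx] exI[of _ ?\<psi>]) auto
    then show ?thesis by blast
  next
    case False
    then obtain a b where ab: "a \<in> verts S" "b \<in> verts S" "a \<noteq> b" "idx a = idx b"
      by (auto simp: inj_on_def)
    let ?F = "{x\<in>verts S. idx x = idx a}"
    have "idx a < t" using less.prems(2) ab by blast
    then have "(adjacent_in S ?F)\<^sup>*\<^sup>* a b"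
      using less.prems(3)[of "idx a"] ab by (auto simp: connected_in_def)
    then obtain v where "adjacent_in S ?F a v"
      using ab(3) by (metis converse_rtranclpE)
    then obtain e where e: "e \<in> edges S" "ends S e = {a, v}" and v: "v \<in> verts S" "idx v = idx a"
      by (auto simp: adjacent_in_def)
    have av: "a \<noteq> v" using less.prems(1) e by (auto simp: multigraph_def)
    define r where "r = (\<lambda>x. if x = v then a else x)"
    define N where "N = identify a v S"
    have vN: "verts N = verts S - {v}"
      and eN: "edges N = {f\<in>edges S. ends S f \<noteq> {a, v}}" and endN: "\<And>f. ends N f = r ` ends S f"
      by (auto simp: N_def identify_def r_def)
    have idxr: "idx (r x) = idx x" for x using v by (simp add: r_def)
    then have imN: "idx ` ends N f = idx ` ends S f" for f
      by (simp add: endN image_image)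
    have step: "edge_contraction S N" using e by (auto simp: edge_contraction_def N_def)
    have "\<exists>M. edge_contraction\<^sup>*\<^sup>* N M \<and> mgraph_iso M (complete_mgraph t)"
    proof (rule less.hyps)
      show "card (verts N) < card (verts S)"
        using less.prems(1) v unfolding vN by (intro card_Diff1_less) (auto simp: multigraph_def)
      show "multigraph N" unfolding N_def by (rule multigraph_identify[OF less.prems(1) av ab(1)])
      have "idx ` (verts S - {v}) = idx ` verts S"
        using ab(1) av v by (auto simp: image_iff)
      then show "idx ` verts N = {..<t}" using less.prems(2) by (simp add: vN)
      show "connected_in N {x\<in>verts N. idx x = i}" if "i < t" for i
      proof -
        let ?A = "{x\<in>verts S. idx x = i}" and ?A' = "{x\<in>verts N. idx x = i}"
        have mem: "r x \<in> ?A'" if "x \<in> ?A" for x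
          using that v ab av by (auto simp: r_def vN)
        have "(adjacent_in N ?A')\<^sup>*\<^sup>* (r x) (r y)" if "(adjacent_in S ?A)\<^sup>*\<^sup>* x y" for x y
          using that
        proof (induction rule: rtranclp_induct)
          case (step y z)
          then obtain f where f: "f \<in> edges S" "ends S f = {y, z}" and yz: "y \<in> ?A" "z \<in> ?A"
            by (auto simp: adjacent_in_def)
          show ?case
          proof (cases "ends S f = {a, v}")
            case True
            then have "r y = r z" using f by (auto simp: doubleton_eq_iff r_def)
            then show ?thesis using step.IH by simp
          next
            case False
            then have "adjacent_in N ?A' (r y) (r z)"
              using f mem[OF yz(1)] mem[OF yz(2)] unfolding adjacent_in_def eN endN
              by (intro conjI bexI[of _ f]) auto
            then show ?thesis using step.IH by (rule rtranclp.rtrancl_into_rtrancl[rotated])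
          qed
        qed simp
        moreover have "r x = x" if "x \<in> ?A'" for x using that by (auto simp: r_def vN)
        ultimately show ?thesis
          using less.prems(3)[OF \<open>i < t\<close>] unfolding connected_in_def vN
          by (metis (no_types, lifting) DiffE mem_Collect_eq)
      qed
      show "\<exists>!e. e \<in> edges N \<and> idx ` ends N e = {i, j}" if ij: "i < t" "j < t" "i \<noteq> j" for i j
      proof -
        have "f \<in> edges N \<longleftrightarrow> f \<in> edges S" if "idx ` ends S f = {i, j}" for f
          using that ij v unfolding eN by auto
        then have "(f \<in> edges N \<and> idx ` ends N f = {i, j}) \<longleftrightarrow> (f \<in> edges S \<and> idx ` ends S f = {i, j})" for f
          unfolding imN by blast
        then show ?thesis using less.prems(4)[OF ij] by simp
      qed
    qed
    then show ?thesis using step by (meson converse_rtranclp_into_rtranclp)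
  qed
qed

lemma clique_model_imp_has_minor:
  assumes G: "multigraph G" and model: "clique_model G {..<t} B"
  shows "has_minor G (complete_mgraph t)"
proof -
  have B: "B i \<noteq> {}" "B i \<subseteq> verts G" "connected_in G (B i)" if "i < t" for i
    using model that by (auto simp: clique_model_def)
  have disj: "i = j" if "i < t" "j < t" "x \<in> B i" "x \<in> B j" for i j x
    using model that unfolding clique_model_def by (metis disjoint_iff lessThan_iff)
  have "\<forall>i j. \<exists>e. i < t \<and> j < t \<and> i \<noteq> j \<longrightarrow> e \<in> edges G \<and> (\<exists>x\<in>B i. \<exists>y\<in>B j. ends G e = {x, y})"
    using model unfolding clique_model_def by (metis lessThan_iff)
  then obtain c where c: "\<And>i j. i < t \<Longrightarrow> j < t \<Longrightarrow> i \<noteq> j \<Longrightarrow>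
      c i j \<in> edges G \<and> (\<exists>x\<in>B i. \<exists>y\<in>B j. ends G (c i j) = {x, y})"
    by metis
  define V where "V = (\<Union>i<t. B i)"
  define C where "C = {c i j | i j. i < j \<and> j < t}"
  define idx where "idx x = (THE i. i < t \<and> x \<in> B i)" for x
  have idx: "idx x = i" if "i < t" "x \<in> B i" for x i
    unfolding idx_def using that disj by blast
  define S where "S = \<lparr> verts = V, edges = {e\<in>edges G. \<exists>i<t. ends G e \<subseteq> B i} \<union> C, ends = ends G \<rparr>"
  have C: "e \<in> edges G \<and> (\<exists>i j. i < j \<and> j < t \<and> e = c i j \<and> (\<exists>x\<in>B i. \<exists>y\<in>B j. ends G e = {x, y}))"
    if "e \<in> C" for e
  proof -
    obtain i j where ij: "e = c i j" "i < j" "j < t" using \<open>e \<in> C\<close> by (auto simp: C_def)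
    then show ?thesis using c[of i j] by (intro conjI exI[of _ i] exI[of _ j]) auto
  qed
  have S: "subgraph S G"
  proof -
    have VG: "V \<subseteq> verts G" using B by (auto simp: V_def)
    have "ends G e \<subseteq> V" if "e \<in> edges S" for e
    proof (cases "e \<in> C")
      case True
      then obtain i j x y where "i < t" "j < t" "x \<in> B i" "y \<in> B j" "ends G e = {x, y}"
        using C[OF True] by (metis less_trans)
      then show ?thesis by (auto simp: V_def)
    next
      case False
      then show ?thesis using that by (auto simp: S_def V_def)
    qed
    moreover have "edges S \<subseteq> edges G" using C by (auto simp: S_def)
    ultimately show ?thesis
      using VG G finite_subset[OF VG] finite_subset[of "edges S" "edges G"]
      by (auto simp: subgraph_def multigraph_def S_def)
  qed
  have fib: "{x\<in>verts S. idx x = i} = B i" if "i < t" for i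
    using that idx by (auto simp: S_def V_def)
  have "\<exists>M. edge_contraction\<^sup>*\<^sup>* S M \<and> mgraph_iso M (complete_mgraph t)"
  proof (rule contract_fibres)
    show "multigraph S" using S by (simp add: subgraph_def)
    show "idx ` verts S = {..<t}"
      using idx B(1) by (force simp: S_def V_def image_iff)
    show "connected_in S {x\<in>verts S. idx x = i}" if "i < t" for i
    proof -
      have "adjacent_in S (B i) x y" if "adjacent_in G (B i) x y" for x y
      proof -
        obtain e where "e \<in> edges G" "ends G e = {x, y}" "x \<in> B i" "y \<in> B i"
          using \<open>adjacent_in G (B i) x y\<close> by (auto simp: adjacent_in_def)
        then show ?thesis
          using \<open>i < t\<close> unfolding adjacent_in_def S_def by (intro conjI bexI[of _ e]) auto
      qed
      then have "adjacent_in G (B i) \<le> adjacent_in S (B i)" by blast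
      then have "(adjacent_in S (B i))\<^sup>*\<^sup>* x y" if "(adjacent_in G (B i))\<^sup>*\<^sup>* x y" for x y
        using that by (meson rtranclp_mono predicate2D)
      then show ?thesis using B(3)[OF that] by (simp add: fib[OF that] connected_in_def)
    qed
    show "\<exists>!e. e \<in> edges S \<and> idx ` ends S e = {i, j}" if ij: "i < t" "j < t" "i \<noteq> j" for i j
    proof -
      define e where "e = c (min i j) (max i j)"
      have mm: "min i j < max i j" "max i j < t" "{min i j, max i j} = {i, j}"
        using ij by (auto simp: min_def max_def)
      have ce: "idx ` ends G (c k m) = {k, m}" if km: "k < m" "m < t" for k m
      proof -
        obtain x y where "x \<in> B k" "y \<in> B m" "ends G (c k m) = {x, y}"
          using c[of k m] km by auto
        then show ?thesis using idx[of k x] idx[of m y] km by simp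
      qed
      have "e \<in> C" using mm(1,2) unfolding C_def e_def by blast
      moreover have "idx ` ends G e = {i, j}" using ce[OF mm(1,2)] mm(3) by (simp add: e_def)
      moreover have "f = e" if f: "f \<in> edges S" "idx ` ends G f = {i, j}" for f
      proof -
        have False if "f \<in> edges G" "k < t" "ends G f \<subseteq> B k" for k
        proof -
          have "idx ` ends G f \<subseteq> {k}" using that idx by auto
          then show False using f(2) ij(3) by auto
        qed
        then obtain k m where km: "k < m" "m < t" "f = c k m"
          using f(1) by (auto simp: S_def C_def)
        then have "{k, m} = {i, j}" using ce f(2) by simp
        then have "k = min i j" "m = max i j" using km(1) by (auto simp: doubleton_eq_iff)
        then show ?thesis using km(3) by (simp add: e_def)
      qed
      ultimately show ?thesis by (intro ex1I[of _ e]) (auto simp: S_def)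
    qed
  qed
  then show ?thesis using S by (auto simp: has_minor_def)
qed

lemma clique_model_le_hadwiger:
  assumes "multigraph G" "clique_model G {..<t} B"
  shows "t \<le> hadwiger G"
  using clique_model_imp_has_minor[OF assms] hadwiger_set[OF assms(1)]
  by (simp add: hadwiger_def)

lemma hadwiger_clique_model:
  assumes "multigraph G"
  shows "\<exists>B. clique_model G {..<hadwiger G} B"
  using Max_in[OF hadwiger_set[OF assms]] has_minor_imp_clique_model
  by (simp add: hadwiger_def)


section \<open>Non-backtracking walks\<close>

text \<open>An arc with at least one edge is stored as the list of its oriented edges. Concatenation and
  reversal then become list operations, and an arc of length 0, which would need a vertex of
  its own, is the empty list between two equal vertices.\<close>

type_synonym ('v, 'e) dart = "'v \<times> 'e \<times> 'v"

abbreviation src :: "('v, 'e) dart \<Rightarrow> 'v" where "src d \<equiv> fst d"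
abbreviation edge :: "('v, 'e) dart \<Rightarrow> 'e" where "edge d \<equiv> fst (snd d)"
abbreviation tgt :: "('v, 'e) dart \<Rightarrow> 'v" where "tgt d \<equiv> snd (snd d)"

definition flip :: "('v, 'e) dart \<Rightarrow> ('v, 'e) dart" where
  "flip d = (tgt d, edge d, src d)"

lemma flip_simps [simp]:
  "src (flip d) = tgt d" "tgt (flip d) = src d" "edge (flip d) = edge d" "flip (flip d) = d"
  by (simp_all add: flip_def)

definition darts :: "('v, 'e) mgraph \<Rightarrow> ('v, 'e) dart set" where
  "darts G = {d. edge d \<in> edges G \<and> ends G (edge d) = {src d, tgt d}}"

lemma flip_darts [simp]: "flip d \<in> darts G \<longleftrightarrow> d \<in> darts G"
  by (auto simp: darts_def)

definition follows :: "('v, 'e) dart \<Rightarrow> ('v, 'e) dart \<Rightarrow> bool" where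
  "follows d d' \<longleftrightarrow> tgt d = src d' \<and> edge d \<noteq> edge d'"

lemma follows_flip [simp]: "follows (flip d) (flip d') \<longleftrightarrow> follows d' d"
  by (auto simp: follows_def)

definition nb_walk :: "('v, 'e) mgraph \<Rightarrow> ('v, 'e) dart list \<Rightarrow> bool" where
  "nb_walk G xs \<longleftrightarrow> set xs \<subseteq> darts G \<and> successively follows xs"

lemma nb_walk_Nil [simp]: "nb_walk G []"
  by (simp add: nb_walk_def)

lemma nb_walk_append:
  "nb_walk G (xs @ ys) \<longleftrightarrow> nb_walk G xs \<and> nb_walk G ys \<and>
     (xs \<noteq> [] \<longrightarrow> ys \<noteq> [] \<longrightarrow> follows (last xs) (hd ys))"
  by (auto simp: nb_walk_def successively_append_iff)

lemma nb_walk_Cons: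
  "nb_walk G (d # xs) \<longleftrightarrow> d \<in> darts G \<and> nb_walk G xs \<and> (xs \<noteq> [] \<longrightarrow> follows d (hd xs))"
  by (auto simp: nb_walk_def successively_Cons)

lemma nb_walk_take: "nb_walk G xs \<Longrightarrow> nb_walk G (take n xs)"
  by (metis append_take_drop_id nb_walk_append)

lemma nb_walk_drop: "nb_walk G xs \<Longrightarrow> nb_walk G (drop n xs)"
  by (metis append_take_drop_id nb_walk_append)

definition rev_walk :: "('v, 'e) dart list \<Rightarrow> ('v, 'e) dart list" where
  "rev_walk xs = rev (map flip xs)"

lemma rev_walk_simps [simp]:
  "rev_walk [] = []" "length (rev_walk xs) = length xs" "rev_walk xs = [] \<longleftrightarrow> xs = []"
  "rev_walk (rev_walk xs) = xs" "rev_walk (xs @ ys) = rev_walk ys @ rev_walk xs"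
  "rev_walk (d # xs) = rev_walk xs @ [flip d]" "edge ` set (rev_walk xs) = edge ` set xs"
  by (auto simp: rev_walk_def rev_map o_def image_image)

lemma hd_rev_walk: "xs \<noteq> [] \<Longrightarrow> hd (rev_walk xs) = flip (last xs)"
  by (simp add: rev_walk_def hd_rev last_map)

lemma last_rev_walk: "xs \<noteq> [] \<Longrightarrow> last (rev_walk xs) = flip (hd xs)"
  by (simp add: rev_walk_def last_rev hd_map)

lemma set_rev_walk: "set (rev_walk xs) = flip ` set xs"
  by (simp add: rev_walk_def)

lemma nb_walk_rev_walk [simp]: "nb_walk G (rev_walk xs) \<longleftrightarrow> nb_walk G xs"
proof -
  have "flip ` set xs \<subseteq> darts G \<longleftrightarrow> set xs \<subseteq> darts G" by auto
  then show ?thesis by (simp add: nb_walk_def rev_walk_def successively_map)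
qed

text \<open>The vertex at position \<open>k\<close> of the underlying arc, meaningful for \<open>k \<le> length xs\<close> and nonempty \<open>xs\<close>.\<close>

definition vtx :: "('v, 'e) dart list \<Rightarrow> nat \<Rightarrow> 'v" where
  "vtx xs k = (if k = 0 then src (hd xs) else tgt (xs ! (k - 1)))"

lemma vtx_nth:
  assumes "nb_walk G xs" "k < length xs"
  shows "vtx xs k = src (xs ! k)"
proof (cases k)
  case 0
  then show ?thesis using assms(2) by (simp add: vtx_def hd_conv_nth)
next
  case (Suc m)
  then have "follows (xs ! m) (xs ! k)"
    using assms by (auto simp: nb_walk_def dest: successively_nth)
  then show ?thesis by (simp add: vtx_def Suc follows_def)
qed

lemma vtx_Suc: "vtx xs (Suc k) = tgt (xs ! k)"
  by (simp add: vtx_def)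

lemma vtx_length: "xs \<noteq> [] \<Longrightarrow> vtx xs (length xs) = tgt (last xs)"
  by (simp add: vtx_def last_conv_nth)

lemma vtx_rev_walk:
  assumes "nb_walk G xs" "xs \<noteq> []" "k \<le> length xs"
  shows "vtx (rev_walk xs) k = vtx xs (length xs - k)"
proof (cases k)
  case 0
  then show ?thesis
    using assms(2) by (simp add: vtx_length) (simp add: vtx_def hd_rev_walk)
next
  case (Suc m)
  then have "vtx (rev_walk xs) k = src (xs ! (length xs - k))"
    using assms(3) by (simp add: vtx_Suc rev_walk_def rev_nth)
  then show ?thesis using vtx_nth[OF assms(1), of "length xs - k"] Suc assms(3) by simp
qed

lemma vtx_append1: "k \<le> length xs \<Longrightarrow> xs \<noteq> [] \<Longrightarrow> vtx (xs @ ys) k = vtx xs k"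
  by (auto simp: vtx_def nth_append)

lemma vtx_append2:
  assumes "nb_walk G (xs @ ys)" "ys \<noteq> []"
  shows "vtx (xs @ ys) (length xs + k) = vtx ys k"
proof (cases k)
  case 0
  then show ?thesis
    using vtx_nth[OF assms(1), of "length xs"] assms(2) by (simp add: nth_append vtx_def hd_conv_nth)
next
  case (Suc m)
  then show ?thesis by (simp add: vtx_def nth_append)
qed

definition window :: "nat \<Rightarrow> ('v, 'e) dart list \<Rightarrow> nat \<Rightarrow> ('v, 'e) dart list" where
  "window l xs s = take l (drop s xs)"

lemma length_window [simp]: "s + l \<le> length xs \<Longrightarrow> length (window l xs s) = l"
  by (simp add: window_def)

lemma nb_walk_window: "nb_walk G xs \<Longrightarrow> nb_walk G (window l xs s)"
  by (simp add: window_def nb_walk_take nb_walk_drop)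

lemma nth_window: "s + l \<le> length xs \<Longrightarrow> k < l \<Longrightarrow> window l xs s ! k = xs ! (s + k)"
  by (simp add: window_def)

lemma set_window:
  assumes "s + l \<le> length xs"
  shows "set (window l xs s) = (!) xs ` {s..<s + l}"
proof -
  have "set (window l xs s) = (!) (window l xs s) ` {0..<l}"
    using nth_image[of l "window l xs s"] assms by simp
  also have "\<dots> = (\<lambda>k. xs ! (s + k)) ` {0..<l}"
    using nth_window[OF assms] by (intro image_cong) auto
  also have "\<dots> = (!) xs ` ((+) s ` {0..<l})"
    by (simp only: image_image)
  finally show ?thesis by (simp add: add.commute)
qed

lemma vtx_window:
  assumes "nb_walk G xs" "s + l \<le> length xs" "k \<le> l" "l > 0"
  shows "vtx (window l xs s) k = vtx xs (s + k)"
proof (cases k)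
  case 0
  have "window l xs s \<noteq> []" using assms(2,4) by (auto simp: window_def)
  then show ?thesis
    using 0 assms vtx_nth[OF assms(1), of s] nth_window[OF assms(2), of 0]
    by (simp add: vtx_def hd_conv_nth)
next
  case (Suc m)
  then show ?thesis using assms(2,3) by (simp add: vtx_Suc nth_window)
qed

lemma window_rev_walk:
  assumes "s + l \<le> length xs"
  shows "window l (rev_walk xs) s = rev_walk (window l xs (length xs - l - s))"
proof -
  have "take l (drop s (rev ys)) = rev (take l (drop (length ys - l - s) ys))"
    if "s + l \<le> length ys" for ys :: "('v, 'e) dart list"
    using that by (intro nth_equalityI) (auto simp: rev_nth intro!: arg_cong[of _ _ "(!) ys"])
  from this[of "map flip xs"] show ?thesis
    using assms by (simp add: window_def rev_walk_def take_map drop_map)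
qed

text \<open>Meaningful for nonempty lists only: a walk without darts has no recorded first vertex.\<close>

definition arc_of :: "('v, 'e) dart list \<Rightarrow> ('v, 'e) arc" where
  "arc_of xs = (src (hd xs) # map tgt xs, map edge xs)"

abbreviation walk_link :: "('v, 'e) dart list \<Rightarrow> ('v, 'e) arc set" where
  "walk_link xs \<equiv> link_of (arc_of xs)"

lemma nth_arc_of: "k \<le> length xs \<Longrightarrow> fst (arc_of xs) ! k = vtx xs k"
  by (cases k) (auto simp: arc_of_def vtx_def)

lemma is_arc_arc_of:
  assumes "multigraph G" "nb_walk G xs" "xs \<noteq> []"
  shows "is_arc G (length xs) (arc_of xs)"
proof -
  have d: "xs ! i \<in> darts G" if "i < length xs" for i
    using assms(2) that by (auto simp: nb_walk_def)
  have "src (hd xs) \<in> verts G"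
    using d[of 0] assms(1,3) by (auto simp: darts_def multigraph_def hd_conv_nth)
  moreover have "tgt ` set xs \<subseteq> verts G" "edge ` set xs \<subseteq> edges G"
    using assms(1,2) by (auto simp: darts_def multigraph_def nb_walk_def)
  moreover have "ends G (edge (xs ! i)) = {vtx xs i, vtx xs (Suc i)}" if "i < length xs" for i
    using d[OF that] vtx_nth[OF assms(2) that] by (simp add: darts_def vtx_Suc)
  moreover have "edge (xs ! i) \<noteq> edge (xs ! Suc i)" if "Suc i < length xs" for i
    using successively_nth[of follows xs i] assms(2) that by (simp add: nb_walk_def follows_def)
  ultimately show ?thesis
    using nth_arc_of[of _ xs] by (auto simp: is_arc_def arc_of_def vtx_Suc)
qed

lemma arc_of_rev_walk:
  assumes "nb_walk G xs" "xs \<noteq> []"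
  shows "arc_of (rev_walk xs) = rev_arc (arc_of xs)"
proof -
  have "fst (arc_of (rev_walk xs)) = rev (fst (arc_of xs))"
  proof (rule nth_equalityI)
    show "length (fst (arc_of (rev_walk xs))) = length (rev (fst (arc_of xs)))"
      by (simp add: arc_of_def)
    fix k assume "k < length (fst (arc_of (rev_walk xs)))"
    then have k: "k \<le> length xs" by (simp add: arc_of_def)
    have len: "length (fst (arc_of xs)) = Suc (length xs)" by (simp add: arc_of_def)
    show "fst (arc_of (rev_walk xs)) ! k = rev (fst (arc_of xs)) ! k"
      using k len vtx_rev_walk[OF assms k] by (simp add: nth_arc_of rev_nth)
  qed
  then show ?thesis by (simp add: rev_arc_def prod_eq_iff) (simp add: arc_of_def rev_walk_def rev_map o_def)
qed

lemma arc_of_inj: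
  assumes "nb_walk G xs" "nb_walk G ys" "xs \<noteq> []" "arc_of xs = arc_of ys"
  shows "xs = ys"
proof (rule nth_equalityI)
  show len: "length xs = length ys"
    using arg_cong[OF assms(4), of "\<lambda>a. length (snd a)"] by (simp add: arc_of_def)
  fix k assume k: "k < length xs"
  have v: "vtx xs i = vtx ys i" if "i \<le> length xs" for i
    using that len nth_arc_of[of i xs] nth_arc_of[of i ys] assms(4) by simp
  have "edge (xs ! k) = edge (ys ! k)"
    using arg_cong[OF assms(4), of "\<lambda>a. snd a ! k"] k len by (simp add: arc_of_def)
  then show "xs ! k = ys ! k"
    using v[of k] v[of "Suc k"] k len vtx_nth[OF assms(1) k] vtx_nth[OF assms(2), of k]
    by (simp add: vtx_Suc prod_eq_iff)
qed

lemma walk_link_eqD: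
  assumes "nb_walk G xs" "nb_walk G ys" "xs \<noteq> []" "ys \<noteq> []" "walk_link xs = walk_link ys"
  shows "xs = ys \<or> xs = rev_walk ys"
  using assms arc_of_inj[of G xs ys] arc_of_inj[of G xs "rev_walk ys"] arc_of_rev_walk[of G ys]
  by (auto simp: link_of_eq_iff)

lemma walk_link_rev_walk:
  "nb_walk G xs \<Longrightarrow> xs \<noteq> [] \<Longrightarrow> walk_link (rev_walk xs) = walk_link xs"
  by (simp add: arc_of_rev_walk)

lemma walk_link_in_links:
  assumes "multigraph G" "nb_walk G xs" "xs \<noteq> []"
  shows "walk_link xs \<in> links G (length xs)"
  using is_arc_arc_of[OF assms] by (simp add: links_def)

lemma shunt_edge:
  assumes "multigraph G" "nb_walk G z" "length z = l + 1" "l \<ge> 1"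
  shows "walk_link z \<in> edges (link_graph l G)"
    and "ends (link_graph l G) (walk_link z) = {walk_link (butlast z), walk_link (tl z)}"
    and "walk_link (butlast z) \<noteq> walk_link (tl z)"
proof -
  have ne: "z \<noteq> []" using assms(3) by auto
  have arc: "is_arc G (l + 1) (arc_of z)"
    using is_arc_arc_of[OF assms(1,2) ne] assms(3) by simp
  have "segment (arc_of z) 0 l = arc_of (butlast z)"
    using assms(3,4) by (simp add: segment_def arc_of_def butlast_conv_take take_map hd_take)
  moreover have "segment (arc_of z) 1 (l + 1) = arc_of (tl z)"
  proof -
    obtain d d' xs where z: "z = d # d' # xs"
      using assms(3,4) by (cases z; cases "tl z") auto
    then have "follows d d'" using assms(2) by (simp add: nb_walk_Cons)
    then show ?thesis
      using assms(3) by (simp add: z segment_def arc_of_def follows_def)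
  qed
  ultimately show "walk_link z \<in> edges (link_graph l G)"
    "ends (link_graph l G) (walk_link z) = {walk_link (butlast z), walk_link (tl z)}"
    "walk_link (butlast z) \<noteq> walk_link (tl z)"
    using ends_link_graph[OF arc] link_ends_distinct[OF assms(1) arc] walk_link_in_links[OF assms(1,2) ne] assms(3)
    by (simp_all add: link_graph_def)
qed


section \<open>Cliques from sliding links\<close>

text \<open>Vertices of the link graph are sorted by a label \<open>h\<close>, and a branch set consists of the links of
  label \<open>i\<close> that can be reached from a base link without leaving label \<open>i\<close>. Reversal is admitted as a
  step because it does not change the link; the relation thus lives on walks, where windows are easy
  to compute, and is symmetric.\<close>

definition slide :: "('v, 'e) mgraph \<Rightarrow> nat \<Rightarrow> (('v, 'e) dart list \<Rightarrow> nat) \<Rightarrow> nat \<Rightarrow>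
    ('v, 'e) dart list \<Rightarrow> ('v, 'e) dart list \<Rightarrow> bool" where
  "slide G l h i xs ys \<longleftrightarrow> nb_walk G xs \<and> nb_walk G ys \<and> length xs = l \<and> length ys = l \<and>
     h xs = i \<and> h ys = i \<and>
     (ys = rev_walk xs \<or>
      (\<exists>z. nb_walk G z \<and> length z = l + 1 \<and> {xs, ys} = {butlast z, tl z}))"

abbreviation slides_to :: "('v, 'e) mgraph \<Rightarrow> nat \<Rightarrow> (('v, 'e) dart list \<Rightarrow> nat) \<Rightarrow> nat \<Rightarrow>
    ('v, 'e) dart list \<Rightarrow> ('v, 'e) dart list \<Rightarrow> bool" where
  "slides_to G l h i \<equiv> (slide G l h i)\<^sup>*\<^sup>*"

definition adjacent_slides :: "('v, 'e) mgraph \<Rightarrow> nat \<Rightarrow> (('v, 'e) dart list \<Rightarrow> nat) \<Rightarrow>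
    (nat \<Rightarrow> ('v, 'e) dart list) \<Rightarrow> nat \<Rightarrow> nat \<Rightarrow> bool" where
  "adjacent_slides G l h b i j \<longleftrightarrow> (\<exists>z. nb_walk G z \<and> length z = l + 1 \<and>
     slides_to G l h i (b i) (butlast z) \<and> slides_to G l h j (b j) (tl z))"

lemma slide_sym: "slide G l h i xs ys \<Longrightarrow> slide G l h i ys xs"
  unfolding slide_def by (auto simp: insert_commute)

lemma slides_to_sym:
  assumes "slides_to G l h i xs ys"
  shows "slides_to G l h i ys xs"
proof -
  have "symp (slide G l h i)" by (rule sympI) (rule slide_sym)
  then show ?thesis using assms by (rule symp_rtranclp[THEN sympD])
qed

lemma slides_to_rev_walk:
  assumes "nb_walk G xs" "length xs = l" "h xs = i" "h (rev_walk xs) = i"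
  shows "slides_to G l h i xs (rev_walk xs)"
  using assms by (intro r_into_rtranclp) (simp add: slide_def)

lemma butlast_window: "s + l < length xs \<Longrightarrow> butlast (window (Suc l) xs s) = window l xs s"
  by (simp add: window_def butlast_conv_take)

lemma tl_window: "s + l < length xs \<Longrightarrow> tl (window (Suc l) xs s) = window l xs (Suc s)"
  by (simp add: window_def tl_take drop_Suc drop_tl)

lemma slides_to_window:
  assumes "nb_walk G xs" "a \<le> c" "c + l \<le> length xs"
    and "\<And>s. a \<le> s \<Longrightarrow> s \<le> c \<Longrightarrow> h (window l xs s) = i"
  shows "slides_to G l h i (window l xs a) (window l xs c)"
  using assms(2,3,4)
proof (induction c rule: dec_induct)
  case (step c)
  have "{window l xs c, window l xs (Suc c)}
      = {butlast (window (Suc l) xs c), tl (window (Suc l) xs c)}"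
    using step.prems(1) by (simp add: butlast_window tl_window)
  then have "slide G l h i (window l xs c) (window l xs (Suc c))"
    using step nb_walk_window[OF assms(1)] unfolding slide_def
    by (intro conjI disjI2 exI[of _ "window (Suc l) xs c"]) auto
  moreover have "slides_to G l h i (window l xs a) (window l xs c)"
    using step by simp
  ultimately show ?case by (rule rtranclp.rtrancl_into_rtrancl[rotated])
qed simp

text \<open>A link that runs along a walk in such a way that its label changes just once shows that two
  branch sets are adjacent.\<close>

lemma adjacent_slides_window:
  assumes "nb_walk G xs" "a \<le> m" "m < c" "c + l \<le> length xs"
    and "\<And>s. a \<le> s \<Longrightarrow> s \<le> m \<Longrightarrow> h (window l xs s) = i"
    and "\<And>s. m < s \<Longrightarrow> s \<le> c \<Longrightarrow> h (window l xs s) = j"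
    and "slides_to G l h i (b i) (window l xs a)" "slides_to G l h j (b j) (window l xs c)"
  shows "adjacent_slides G l h b i j"
proof -
  have "slides_to G l h i (window l xs a) (window l xs m)"
    using assms by (intro slides_to_window) auto
  moreover have "slides_to G l h j (window l xs (Suc m)) (window l xs c)"
    using assms by (intro slides_to_window) auto
  ultimately have "slides_to G l h i (b i) (butlast (window (Suc l) xs m))"
    "slides_to G l h j (b j) (tl (window (Suc l) xs m))"
    using assms(3,4,7,8) slides_to_sym by (force simp: butlast_window tl_window)+
  then show ?thesis
    unfolding adjacent_slides_def using assms(1,3,4)
    by (intro exI[of _ "window (Suc l) xs m"]) (simp add: nb_walk_window)
qed

lemma slides_to_label:
  assumes "slides_to G l h i b x" "nb_walk G b" "length b = l" "h b = i"
  shows "nb_walk G x \<and> length x = l \<and> h x = i"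
  using assms by (induction rule: rtranclp_induct) (auto simp: slide_def)

text \<open>It suffices to give one base link for each label and, for every pair of labels, a place where a
  single shift changes one label into the other. Invariance of \<open>h\<close> under reversal makes it a
  function of the link, so that different labels yield disjoint branch sets.\<close>

lemma clique_model_of_slides:
  assumes G: "multigraph G" and l: "l \<ge> 1"
    and h: "\<And>xs. nb_walk G xs \<Longrightarrow> length xs = l \<Longrightarrow> h (rev_walk xs) = h xs"
    and b: "\<And>i. i < t \<Longrightarrow> nb_walk G (b i) \<and> length (b i) = l \<and> h (b i) = i"
    and adj: "\<And>i j. i < j \<Longrightarrow> j < t \<Longrightarrow> adjacent_slides G l h b i j \<or> adjacent_slides G l h b j i"
  shows "clique_model (link_graph l G) {..<t} (\<lambda>i. walk_link ` {x. slides_to G l h i (b i) x})"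
proof -
  let ?L = "link_graph l G" and ?B = "\<lambda>i. walk_link ` {x. slides_to G l h i (b i) x}"
  have lab: "nb_walk G x \<and> length x = l \<and> h x = i \<and> x \<noteq> []"
    if "i < t" "slides_to G l h i (b i) x" for i x
    using slides_to_label[OF that(2)] b[OF that(1)] l by fastforce
  have sub: "?B i \<subseteq> verts ?L" if "i < t" for i
    using walk_link_in_links[OF G] lab[OF that] by (fastforce simp: link_graph_def)
  have conn: "connected_in ?L (?B i)" if i: "i < t" for i
  proof -
    have reach: "(adjacent_in ?L (?B i))\<^sup>*\<^sup>* (walk_link (b i)) (walk_link x)"
      if "slides_to G l h i (b i) x" for x
      using that
    proof (induction rule: rtranclp_induct)
      case (step x y)
      have x: "nb_walk G x" "x \<noteq> []" using lab[OF i step.hyps(1)] by auto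
      have y: "slides_to G l h i (b i) y" using step.hyps by (rule rtranclp.rtrancl_into_rtrancl)
      show ?case
      proof (cases "y = rev_walk x")
        case True
        then show ?thesis using step.IH walk_link_rev_walk[OF x] by simp
      next
        case False
        then obtain z where z: "nb_walk G z" "length z = l + 1" "{x, y} = {butlast z, tl z}"
          using step.hyps(2) by (auto simp: slide_def)
        have "{walk_link x, walk_link y} = {walk_link (butlast z), walk_link (tl z)}"
          using arg_cong[OF z(3), of "\<lambda>A. walk_link ` A"] by simp
        then have "adjacent_in ?L (?B i) (walk_link x) (walk_link y)"
          using shunt_edge(1,2)[OF G z(1,2) l] step.hyps(1) y unfolding adjacent_in_def
          by (intro conjI bexI[of _ "walk_link z"]) auto
        then show ?thesis using step.IH by (rule rtranclp.rtrancl_into_rtrancl[rotated])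
      qed
    qed simp
    show ?thesis
      unfolding connected_in_def
    proof (intro ballI)
      fix u v assume "u \<in> ?B i" "v \<in> ?B i"
      then obtain x y where xy: "u = walk_link x" "slides_to G l h i (b i) x"
        "v = walk_link y" "slides_to G l h i (b i) y" by blast
      show "(adjacent_in ?L (?B i))\<^sup>*\<^sup>* u v"
        unfolding xy(1,3)
        by (rule rtranclp_trans[OF adjacent_in_rtranclp_sym[OF reach[OF xy(2)]] reach[OF xy(4)]])
    qed
  qed
  have disj: "?B i \<inter> ?B j = {}" if ij: "i < t" "j < t" "i \<noteq> j" for i j
  proof -
    have False if "slides_to G l h i (b i) x" "slides_to G l h j (b j) y" "walk_link x = walk_link y" for x y
    proof -
      have "x = y \<or> x = rev_walk y"
        using walk_link_eqD[of G x y] lab[OF ij(1) that(1)] lab[OF ij(2) that(2)] that(3) by blast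
      then show False
        using lab[OF ij(1) that(1)] lab[OF ij(2) that(2)] h[of y] ij(3) by auto
    qed
    then show ?thesis by blast
  qed
  have edge: "\<exists>e\<in>edges ?L. \<exists>x\<in>?B i. \<exists>y\<in>?B j. ends ?L e = {x, y}"
    if adj_ij: "adjacent_slides G l h b i j" for i j
  proof -
    obtain z where z: "nb_walk G z" "length z = l + 1" "slides_to G l h i (b i) (butlast z)"
      "slides_to G l h j (b j) (tl z)"
      using adj_ij by (auto simp: adjacent_slides_def)
    have "walk_link (butlast z) \<in> ?B i" "walk_link (tl z) \<in> ?B j"
      using z(3,4) by (auto intro!: imageI)
    then show ?thesis
      using shunt_edge(1,2)[OF G z(1,2) l] by (meson bexI)
  qed
  have "\<exists>e\<in>edges ?L. \<exists>x\<in>?B i. \<exists>y\<in>?B j. ends ?L e = {x, y}"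
    if ij: "i < t" "j < t" "i \<noteq> j" for i j
  proof -
    consider "adjacent_slides G l h b i j" | "adjacent_slides G l h b j i"
      using adj[of i j] adj[of j i] ij by (meson linorder_neqE_nat)
    then show ?thesis
    proof cases
      case 1
      then show ?thesis by (rule edge)
    next
      case 2
      obtain e x y where e: "e \<in> edges ?L" "x \<in> ?B j" "y \<in> ?B i" "ends ?L e = {x, y}"
        using edge[OF 2] by (elim bexE)
      have "ends ?L e = {y, x}" using e(4) by (simp add: insert_commute)
      then show ?thesis using e(1-3) by (meson bexI)
    qed
  qed
  moreover have "?B i \<noteq> {}" for i by auto
  ultimately show ?thesis
    using sub conn disj unfolding clique_model_def by (intro conjI ballI impI) simp_all
qed


section \<open>Walks inside branch sets\<close>

definition inside :: "'v set \<Rightarrow> ('v, 'e) dart list \<Rightarrow> bool" where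
  "inside B xs \<longleftrightarrow> (\<forall>d\<in>set xs. src d \<in> B \<and> tgt d \<in> B)"

definition joins :: "'v \<Rightarrow> ('v, 'e) dart list \<Rightarrow> 'v \<Rightarrow> bool" where
  "joins x xs y \<longleftrightarrow> (if xs = [] then x = y else src (hd xs) = x \<and> tgt (last xs) = y)"

lemma inside_simps [simp]:
  "inside B []" "inside B (d # xs) \<longleftrightarrow> src d \<in> B \<and> tgt d \<in> B \<and> inside B xs"
  "inside B (xs @ ys) \<longleftrightarrow> inside B xs \<and> inside B ys" "inside B (rev_walk xs) \<longleftrightarrow> inside B xs"
  by (auto simp: inside_def set_rev_walk)

lemma inside_take: "inside B xs \<Longrightarrow> inside B (take n xs)"
  by (metis append_take_drop_id inside_simps(3))

lemma inside_window: "inside B xs \<Longrightarrow> inside B (window l xs s)"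
  unfolding window_def by (metis append_take_drop_id inside_simps(3))

lemma inside_mono: "inside B xs \<Longrightarrow> B \<subseteq> C \<Longrightarrow> inside C xs"
  by (auto simp: inside_def)

lemma inside_vtx: "inside B xs \<Longrightarrow> xs \<noteq> [] \<Longrightarrow> k \<le> length xs \<Longrightarrow> vtx xs k \<in> B"
  by (cases k) (auto simp: inside_def vtx_def)

lemma joins_vtx: "xs \<noteq> [] \<Longrightarrow> joins x xs y \<longleftrightarrow> vtx xs 0 = x \<and> vtx xs (length xs) = y"
  by (simp add: joins_def vtx_length) (simp add: vtx_def)

text \<open>A step that would backtrack cancels the last step instead.\<close>

lemma nb_walk_of_reachable:
  assumes "(adjacent_in G B)\<^sup>*\<^sup>* x y"
  shows "\<exists>xs. nb_walk G xs \<and> inside B xs \<and> joins x xs y"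
  using assms
proof (induction rule: rtranclp_induct)
  case base
  show ?case by (rule exI[of _ "[]"]) (simp add: joins_def)
next
  case (step y z)
  then obtain xs where xs: "nb_walk G xs" "inside B xs" "joins x xs y" by blast
  obtain e where e: "e \<in> edges G" "ends G e = {y, z}" "y \<in> B" "z \<in> B"
    using step.hyps(2) by (auto simp: adjacent_in_def)
  have d: "(y, e, z) \<in> darts G" using e by (simp add: darts_def)
  show ?case
  proof (cases "xs = [] \<or> edge (last xs) \<noteq> e")
    case True
    then show ?thesis
      using xs d e by (intro exI[of _ "xs @ [(y, e, z)]"])
        (auto simp: nb_walk_append nb_walk_Cons follows_def joins_def hd_append split: if_splits)
  next
    case False
    then obtain ys d' where ys: "xs = ys @ [d']" by (metis rev_exhaust)
    have d': "edge d' = e" "tgt d' = y" "{src d', tgt d'} = {y, z}"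
      using False xs(1,3) e by (auto simp: ys joins_def nb_walk_append nb_walk_Cons darts_def)
    then have "src d' = z" by (auto simp: doubleton_eq_iff)
    then have "joins x ys z"
      using xs(1,3) by (auto simp: ys joins_def nb_walk_append follows_def split: if_splits)
    then show ?thesis using xs(1,2) by (auto simp: ys nb_walk_append)
  qed
qed

lemma reachable_of_nb_walk:
  assumes "nb_walk G xs" "inside B xs" "joins x xs y"
  shows "(adjacent_in G B)\<^sup>*\<^sup>* x y"
  using assms
proof (induction xs arbitrary: x)
  case (Cons d xs)
  have "adjacent_in G B x (tgt d)"
    using Cons.prems unfolding adjacent_in_def
    by (intro conjI bexI[of _ "edge d"]) (auto simp: joins_def nb_walk_Cons darts_def)
  moreover have "joins (tgt d) xs y"
    using Cons.prems by (auto simp: joins_def nb_walk_Cons follows_def)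
  then have "(adjacent_in G B)\<^sup>*\<^sup>* (tgt d) y"
    using Cons by (simp add: nb_walk_Cons)
  ultimately show ?case by (rule converse_rtranclp_into_rtranclp)
qed (simp add: joins_def)

lemma connected_in_walk:
  assumes "connected_in G B" "x \<in> B" "y \<in> B"
  obtains xs where "nb_walk G xs" "inside B xs" "joins x xs y"
proof -
  have "(adjacent_in G B)\<^sup>*\<^sup>* x y" using assms by (simp add: connected_in_def)
  then show thesis using nb_walk_of_reachable that by metis
qed

text \<open>Excluding an arbitrary edge \<open>e\<close> expresses that every vertex of \<open>U\<close> has at least two edges within
  \<open>U\<close>: a walk that arrives along \<open>e\<close> can leave again without backtracking.\<close>

definition branching :: "('v, 'e) mgraph \<Rightarrow> 'v set \<Rightarrow> bool" where
  "branching G U \<longleftrightarrow> (\<forall>v\<in>U. \<forall>e. \<exists>e'\<in>edges G. e' \<noteq> e \<and> v \<in> ends G e' \<and> ends G e' \<subseteq> U)"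

lemma branching_dart:
  assumes "multigraph G" "branching G U" "v \<in> U"
  shows "\<exists>d\<in>darts G. src d = v \<and> tgt d \<in> U \<and> edge d \<noteq> e"
proof -
  obtain e' where e': "e' \<in> edges G" "e' \<noteq> e" "v \<in> ends G e'" "ends G e' \<subseteq> U"
    using assms(2,3) unfolding branching_def by blast
  have "card (ends G e') = 2" using assms(1) e'(1) by (auto simp: multigraph_def)
  then obtain a b where "ends G e' = {a, b}" by (auto simp: card_2_iff)
  then obtain w where "ends G e' = {v, w}" using e'(3) by auto
  then show ?thesis using e' by (intro bexI[of _ "(v, e', w)"]) (auto simp: darts_def)
qed

lemma nb_walk_extend:
  assumes "multigraph G" "branching G U" "nb_walk G xs" "xs \<noteq> []" "tgt (last xs) \<in> U"
  shows "\<exists>ys. length ys = n \<and> nb_walk G (xs @ ys) \<and> inside U ys"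
  using assms(3-5)
proof (induction n arbitrary: xs)
  case 0
  then show ?case by (intro exI[of _ "[]"]) auto
next
  case (Suc n)
  obtain d where d: "d \<in> darts G" "src d = tgt (last xs)" "tgt d \<in> U" "edge d \<noteq> edge (last xs)"
    using branching_dart[OF assms(1,2) Suc.prems(3)] by blast
  then have "nb_walk G (xs @ [d])"
    using Suc.prems by (simp add: nb_walk_append nb_walk_Cons follows_def)
  then obtain ys where ys: "length ys = n" "nb_walk G ((xs @ [d]) @ ys)" "inside U ys"
    using Suc.IH[of "xs @ [d]"] d by auto
  then show ?case
    using d Suc.prems(3) by (intro exI[of _ "d # ys"]) auto
qed

lemma long_nb_walk:
  assumes "multigraph G" "branching G U" "U \<noteq> {}"
  shows "\<exists>xs. length xs = n \<and> nb_walk G xs \<and> inside U xs"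
proof (cases n)
  case (Suc m)
  obtain v where "v \<in> U" using assms(3) by blast
  then obtain d where d: "d \<in> darts G" "src d \<in> U" "tgt d \<in> U"
    using branching_dart[OF assms(1,2)] by metis
  then obtain ys where "length ys = m" "nb_walk G ([d] @ ys)" "inside U ys"
    using nb_walk_extend[OF assms(1,2), of "[d]"] by (auto simp: nb_walk_Cons)
  then show ?thesis using d Suc by (intro exI[of _ "d # ys"]) auto
qed (auto intro: exI[of _ "[]"])

text \<open>A vertex \<open>v\<close> with at most one edge \<open>e\<close> into the union of the branch sets can be dropped: it is not a
  whole branch set, since it would then need edges to two other ones; and a non-backtracking walk
  never passes through it, so that the rest of its branch set stays connected.\<close>

lemma clique_model_delete_vertex:
  assumes I: "finite I" "3 \<le> card I" and model: "clique_model G I B"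
    and v: "i \<in> I" "v \<in> B i"
    and e: "\<And>e'. e' \<in> edges G \<Longrightarrow> v \<in> ends G e' \<Longrightarrow> ends G e' \<subseteq> (\<Union>i\<in>I. B i) \<Longrightarrow> e' = e"
  shows "clique_model G I (B(i := B i - {v}))"
proof -
  let ?U = "\<Union>i\<in>I. B i"
  have B: "B i \<noteq> {}" "B i \<subseteq> verts G" "connected_in G (B i)" if "i \<in> I" for i
    using model that by (auto simp: clique_model_def)
  have disj: "B i \<inter> B j = {}" and
    touch: "\<exists>e\<in>edges G. \<exists>x\<in>B i. \<exists>y\<in>B j. ends G e = {x, y}"
    if "i \<in> I" "j \<in> I" "i \<noteq> j" for i j
    using model that unfolding clique_model_def by simp_all
  have e_only: "f = e" if "f \<in> edges G" "ends G f = {v, y}" "y \<in> B j" "j \<in> I" for f y j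
    using e[OF that(1)] that v by auto
  have "\<exists>w. w \<in> B i \<and> w \<noteq> v"
  proof (rule ccontr)
    assume "\<not> ?thesis"
    then have Bi: "B i = {v}" using v by blast
    have "card (I - {i}) \<ge> 2" using I v(1) by simp
    then obtain j k where jk: "j \<in> I" "k \<in> I" "j \<noteq> i" "k \<noteq> i" "j \<noteq> k"
      by (metis (no_types, lifting) Diff_iff card_2_iff' card_le_Suc0_iff_eq finite_Diff I(1)
          insertCI not_less_eq_eq numeral_2_eq_2)
    have "e \<in> edges G \<and> (\<exists>y\<in>B m. ends G e = {v, y})" if m: "m \<in> I" "m \<noteq> i" for m
    proof -
      obtain f y where f: "f \<in> edges G" "y \<in> B m" "ends G f = {v, y}"
        using touch[OF v(1) m(1)] m(2) Bi by auto
      then have "f = e" using e_only m(1) by auto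
      then show ?thesis using f by auto
    qed
    from this[OF jk(1,3)] this[OF jk(2,4)] obtain y z
      where yz: "y \<in> B j" "z \<in> B k" "{v, y} = {v, z}" by auto
    then have "y = z" by (auto simp: doubleton_eq_iff)
    then show False using yz disj[OF jk(1,2,5)] by blast
  qed
  then obtain w where w: "w \<in> B i" "w \<noteq> v" by blast
  \<comment> \<open>The edge \<open>e\<close> is spent on connecting \<open>v\<close> to its own branch set, so it joins no two branch sets.\<close>
  have eB: "ends G e \<subseteq> B i"
  proof -
    obtain xs where xs: "nb_walk G xs" "inside (B i) xs" "joins v xs w"
      using connected_in_walk[OF B(3)[OF v(1)] v(2) w(1)] .
    then have ne: "xs \<noteq> []" using w(2) by (auto simp: joins_def)
    let ?d = "hd xs"
    have d: "?d \<in> darts G" "src ?d = v" "tgt ?d \<in> B i"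
      using xs ne by (auto simp: nb_walk_def joins_def inside_def)
    then have "edge ?d = e" using e_only[of "edge ?d" "tgt ?d" i] v(1) by (auto simp: darts_def)
    then show ?thesis using d v(2) by (auto simp: darts_def)
  qed
  have avoid: "v \<noteq> src d \<and> v \<noteq> tgt d"
    if xs: "nb_walk G xs" "inside (B i) xs" "joins x xs y" "x \<noteq> v" "y \<noteq> v" and d: "d \<in> set xs" for xs x y d
  proof -
    have edge_e: "edge d' = e" if "d' \<in> set xs" "v = src d' \<or> v = tgt d'" for d'
    proof -
      have "d' \<in> darts G" "src d' \<in> B i" "tgt d' \<in> B i"
        using xs that(1) by (auto simp: nb_walk_def inside_def)
      then have "ends G (edge d') = {v, src d'} \<or> ends G (edge d') = {v, tgt d'}"
        using that(2) by (auto simp: darts_def insert_commute)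
      then show ?thesis
        using e_only[of "edge d'" "src d'" i] e_only[of "edge d'" "tgt d'" i] v(1)
          \<open>src d' \<in> B i\<close> \<open>tgt d' \<in> B i\<close> \<open>d' \<in> darts G\<close> by (auto simp: darts_def)
    qed
    have ne: "xs \<noteq> []" using d by auto
    have "v \<noteq> vtx xs k" if k: "k \<le> length xs" for k
    proof
      assume vk: "v = vtx xs k"
      have "k \<noteq> 0" using vk xs(3,4) ne by (intro notI) (simp add: joins_vtx)
      moreover have "k \<noteq> length xs" using vk xs(3,5) ne by (intro notI) (simp add: joins_vtx)
      ultimately obtain m where m: "k = Suc m" "Suc m < length xs" using k by (cases k) auto
      have "v = tgt (xs ! m)" "v = src (xs ! Suc m)"
        using vk m vtx_nth[OF xs(1), of "Suc m"] by (auto simp: vtx_Suc)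
      then have "edge (xs ! m) = edge (xs ! Suc m)" using edge_e m by simp
      moreover have "follows (xs ! m) (xs ! Suc m)"
        using xs(1) m by (auto simp: nb_walk_def dest: successively_nth)
      ultimately show False by (simp add: follows_def)
    qed
    moreover obtain k where "k < length xs" "d = xs ! k" using d by (auto simp: in_set_conv_nth)
    ultimately show ?thesis
      using vtx_nth[OF xs(1), of k] vtx_Suc[of xs k] by (metis Suc_leI less_imp_le)
  qed
  define B' where "B' = B(i := B i - {v})"
  have B'i: "B' i = B i - {v}" and B'j: "\<And>j. j \<noteq> i \<Longrightarrow> B' j = B j" and B'B: "\<And>j. B' j \<subseteq> B j"
    by (auto simp: B'_def)
  have conn: "connected_in G (B' i)"
    unfolding connected_in_def
  proof (intro ballI)
    fix x y assume xy: "x \<in> B' i" "y \<in> B' i"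
    then have xy': "x \<in> B i" "y \<in> B i" "x \<noteq> v" "y \<noteq> v" by (auto simp: B'i)
    obtain xs where xs: "nb_walk G xs" "inside (B i) xs" "joins x xs y"
      using connected_in_walk[OF B(3)[OF v(1)] xy'(1,2)] .
    have "inside (B' i) xs"
      using xs(2) avoid[OF xs xy'(3,4)] by (auto simp: B'i inside_def)
    then show "(adjacent_in G (B' i))\<^sup>*\<^sup>* x y" by (rule reachable_of_nb_walk[OF xs(1) _ xs(3)])
  qed
  have touch': "\<exists>f\<in>edges G. \<exists>x\<in>B' i. \<exists>y\<in>B j. ends G f = {x, y}" if j: "j \<in> I" "j \<noteq> i" for j
  proof -
    obtain f x y where f: "f \<in> edges G" "x \<in> B i" "y \<in> B j" "ends G f = {x, y}"
      using touch[OF v(1) j(1)] j(2) by metis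
    have "x \<noteq> v"
    proof
      assume "x = v"
      then have "f = e" using e_only[of f y j] f j(1) by simp
      then show False using eB f clique_model_disjoint[OF model v(1) j(1), of y] j(2) by auto
    qed
    then show ?thesis using f B'i by (metis Diff_iff singletonD)
  qed
  show ?thesis
    unfolding B'_def[symmetric]
    unfolding clique_model_def
  proof (intro conjI ballI impI)
    fix j assume j: "j \<in> I"
    show "B' j \<noteq> {}" "B' j \<subseteq> verts G" "connected_in G (B' j)"
      using w conn B[OF j] B'B[of j] by (cases "j = i"; auto simp: B'i B'j)+
    fix k assume k: "k \<in> I" "j \<noteq> k"
    show "B' j \<inter> B' k = {}" using disj[OF j k] B'B[of j] B'B[of k] by blast
    consider "j = i" | "k = i" | "j \<noteq> i" "k \<noteq> i" by blast
    then show "\<exists>e\<in>edges G. \<exists>x\<in>B' j. \<exists>y\<in>B' k. ends G e = {x, y}"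
    proof cases
      case 1
      then show ?thesis using touch'[OF k(1)] k(2) by (simp add: B'j)
    next
      case 2
      obtain f x y where "f \<in> edges G" "x \<in> B' i" "y \<in> B j" "ends G f = {y, x}"
        using touch'[OF j] k(2) 2 by (auto simp: insert_commute)
      then show ?thesis using 2 k(2) B'j by metis
    next
      case 3
      then show ?thesis using touch[OF j k] by (simp add: B'j)
    qed
  qed
qed

text \<open>Deleting such vertices one after the other ends with a model in which there are none.\<close>

lemma clique_model_branching:
  assumes G: "multigraph G" and I: "finite I" "3 \<le> card I" and model: "clique_model G I B"
  shows "\<exists>B'. clique_model G I B' \<and> (\<forall>i\<in>I. B' i \<subseteq> B i) \<and> branching G (\<Union>i\<in>I. B' i)"
  using model
proof (induction "card (\<Union>i\<in>I. B i)" arbitrary: B rule: less_induct)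
  case less
  let ?U = "\<Union>i\<in>I. B i"
  show ?case
  proof (cases "branching G ?U")
    case True
    with less.prems show ?thesis by (intro exI[of _ B] conjI ballI subset_refl)
  next
    case False
    then have "\<exists>v\<in>?U. \<exists>e. \<not> (\<exists>e'\<in>edges G. e' \<noteq> e \<and> v \<in> ends G e' \<and> ends G e' \<subseteq> ?U)"
      unfolding branching_def Ball_def Bex_def by (simp only: not_all not_imp)
    then obtain v e where "v \<in> ?U"
      and ne: "\<not> (\<exists>e'\<in>edges G. e' \<noteq> e \<and> v \<in> ends G e' \<and> ends G e' \<subseteq> ?U)"
      by (elim bexE exE)
    then obtain i where v: "i \<in> I" "v \<in> B i" by (elim UN_E)
    define B' where "B' = B(i := B i - {v})"
    have "clique_model G I B'"
      unfolding B'_def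
    proof (rule clique_model_delete_vertex[OF I less.prems v])
      fix f assume "f \<in> edges G" "v \<in> ends G f" "ends G f \<subseteq> ?U"
      then show "f = e" using ne by (metis bexI)
    qed
    moreover have "card (\<Union>i\<in>I. B' i) < card ?U"
    proof (rule psubset_card_mono)
      have "B i \<subseteq> verts G" if "i \<in> I" for i
        using less.prems that by (simp add: clique_model_def)
      then show "finite ?U"
        using G by (intro finite_subset[of ?U "verts G"]) (auto simp: multigraph_def)
      have "v \<notin> B' j" if "j \<in> I" for j
        using clique_model_disjoint[OF less.prems v(1) that v(2)] by (auto simp: B'_def)
      moreover have "B' j \<subseteq> B j" for j by (simp add: B'_def)
      ultimately show "(\<Union>i\<in>I. B' i) \<subset> ?U" using v by blast
    qed
    ultimately obtain B'' where "clique_model G I B''" "\<forall>i\<in>I. B'' i \<subseteq> B' i" "branching G (\<Union>i\<in>I. B'' i)"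
      using less.hyps[of B'] by meson
    moreover have "B' j \<subseteq> B j" for j by (simp add: B'_def)
    ultimately show ?thesis by (meson order_trans)
  qed
qed


text \<open>The walk \<open>P\<close> meets the middle third of \<open>T\<close> for the first time at the vertex of index \<open>l + k\<close>, so its last
  edge is not in the middle third and turning into \<open>T\<close> does not backtrack. The lower bound on \<open>k\<close> leaves at
  least half of the middle third ahead, hence the final window has its middle there.\<close>

lemma approach_walk_down:
  assumes T: "nb_walk G T" "length T = 3 * l" and l: "l \<ge> 1"
    and mid: "\<And>k. l \<le> k \<Longrightarrow> k \<le> 2 * l \<Longrightarrow> vtx T k \<in> B"
    and f: "f \<in> darts G" "src f \<notin> vtx T ` {l..2 * l}"
    and P: "nb_walk G (f # P)" "inside B P" "joins (tgt f) P (vtx T (l + k))"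
      "\<And>d. d \<in> set P \<Longrightarrow> src d \<notin> vtx T ` {l..2 * l}"
    and k: "k \<le> l" "l - l div 2 \<le> k"
  defines "Z \<equiv> P @ rev_walk (window l T k)"
  shows "nb_walk G (f # Z)" and "length Z = length P + l"
    and "\<And>r. r \<le> length P + (l - l div 2) \<Longrightarrow> vtx Z r \<in> B"
    and "window l Z (length P) = rev_walk (window l T k)"
proof -
  let ?W = "window l T k" and ?S = "vtx T ` {l..2 * l}"
  have lenW: "length ?W = l" using k T(2) by simp
  then have neW: "?W \<noteq> []" using l by auto
  have k1: "k \<ge> 1" using k(2) l by linarith
  have lastW: "last ?W = T ! (l + k - 1)"
    using neW lenW nth_window[of k l T "l - 1"] k T(2) l by (simp add: last_conv_nth add.commute)
  have srcW: "src (last ?W) = vtx T (l + k - 1)" and tgtW: "tgt (last ?W) = vtx T (l + k)"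
    using vtx_nth[OF T(1), of "l + k - 1"] vtx_Suc[of T "l + k - 1"] k k1 T(2) l lastW by simp_all
  have S: "src (last ?W) \<in> ?S" "tgt (last ?W) \<in> ?S"
    unfolding srcW tgtW using k k1 by (auto intro!: imageI)
  let ?x = "last (f # P)"
  have x: "?x \<in> darts G" "tgt ?x = vtx T (l + k)" "src ?x \<notin> ?S"
    using f P by (auto simp: nb_walk_def joins_def split: if_splits)
  have W: "last ?W \<in> darts G"
    using nb_walk_window[OF T(1), of l k] last_in_set[OF neW] unfolding nb_walk_def by (meson subsetD)
  have "edge ?x \<noteq> edge (last ?W)"
  proof
    assume "edge ?x = edge (last ?W)"
    then have "{src ?x, tgt ?x} = {src (last ?W), tgt (last ?W)}"
      using x(1) W by (simp add: darts_def)
    then show False using S x(3) by (auto simp: doubleton_eq_iff)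
  qed
  then have "follows ?x (hd (rev_walk ?W))"
    using x(2) tgtW by (simp add: hd_rev_walk[OF neW] follows_def)
  then have "nb_walk G ((f # P) @ rev_walk ?W)"
    unfolding nb_walk_append[of G "f # P"] using P(1) nb_walk_window[OF T(1)] by simp
  then show nb: "nb_walk G (f # Z)" by (simp add: Z_def)
  show "length Z = length P + l" using lenW by (simp add: Z_def)
  show "window l Z (length P) = rev_walk ?W" using lenW by (simp add: Z_def window_def)
  have nbZ: "nb_walk G (P @ rev_walk ?W)" using nb by (simp add: Z_def nb_walk_Cons)
  show "vtx Z r \<in> B" if r: "r \<le> length P + (l - l div 2)" for r
  proof (cases "r \<le> length P \<and> P \<noteq> []")
    case True
    then show ?thesis using inside_vtx[OF P(2)] by (simp add: Z_def vtx_append1)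
  next
    case False
    define m where "m = r - length P"
    have m: "r = length P + m" "m \<le> l - l div 2" using False r by (auto simp: m_def)
    have "vtx Z r = vtx (rev_walk ?W) m"
      unfolding Z_def m(1) using neW by (intro vtx_append2[OF nbZ]) simp
    also have "\<dots> = vtx ?W (l - m)"
      using vtx_rev_walk[OF nb_walk_window[OF T(1)] neW, of m] m(2) lenW by simp
    also have "\<dots> = vtx T (k + (l - m))"
      using T k l m(2) by (intro vtx_window) auto
    finally show ?thesis using mid[of "k + (l - m)"] k m(2) by simp
  qed
qed

text \<open>Only the middle third of \<open>T\<close> is known to lie in \<open>B\<close>. A walk entering \<open>B\<close> can be continued until its last
  \<open>l\<close> edges are a window of \<open>T\<close>, where only the part beyond the middle of that window may leave \<open>B\<close>:
  where the walk meets the middle third, one of the two directions along \<open>T\<close> has at least half of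
  the middle third ahead.\<close>

lemma approach_walk:
  assumes B: "connected_in G B" and T: "nb_walk G T" "length T = 3 * l" and l: "l \<ge> 1"
    and mid: "\<And>k. l \<le> k \<Longrightarrow> k \<le> 2 * l \<Longrightarrow> vtx T k \<in> B"
    and f: "f \<in> darts G" "src f \<notin> B" "tgt f \<in> B"
  obtains Z s where "nb_walk G (f # Z)" "length Z \<ge> l"
    "\<And>r. r \<le> length Z - l div 2 \<Longrightarrow> vtx Z r \<in> B"
    "l - l div 2 \<le> s" "s \<le> l + l div 2"
    "window l Z (length Z - l) \<in> {window l T s, rev_walk (window l T s)}"
    "\<And>C. B \<subseteq> C \<Longrightarrow> inside C T \<Longrightarrow> inside C Z"
proof -
  let ?S = "vtx T ` {l..2 * l}"
  have SB: "?S \<subseteq> B" using mid by auto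
  obtain P0 where P0: "nb_walk G P0" "inside B P0" "joins (tgt f) P0 (vtx T l)"
    using connected_in_walk[OF B f(3) mid[of l]] by (metis le_add1 mult_2 order_refl)
  define P where "P = takeWhile (\<lambda>d. src d \<notin> ?S) P0"
  define Q where "Q = dropWhile (\<lambda>d. src d \<notin> ?S) P0"
  have PQ: "P0 = P @ Q" by (simp add: P_def Q_def)
  have P: "nb_walk G P" "inside B P" "\<And>d. d \<in> set P \<Longrightarrow> src d \<notin> ?S"
    using P0 by (auto simp: PQ nb_walk_append) (auto simp: P_def dest: set_takeWhileD)
  have "\<exists>y\<in>?S. joins (tgt f) P y"
  proof (cases "Q = []")
    case True
    then show ?thesis using P0(3) PQ by (intro bexI[of _ "vtx T l"]) auto
  next
    case False
    then have "\<not> src (hd Q) \<notin> ?S" unfolding Q_def by (rule hd_dropWhile)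
    then have "src (hd Q) \<in> ?S" by simp
    moreover have "joins (tgt f) P (src (hd Q))"
      using P0(1,3) False by (auto simp: PQ joins_def nb_walk_append follows_def)
    ultimately show ?thesis by blast
  qed
  then obtain k' where k': "l \<le> k'" "k' \<le> 2 * l" "joins (tgt f) P (vtx T k')" by auto
  define k where "k = k' - l"
  have k: "k \<le> l" "joins (tgt f) P (vtx T (l + k))" using k' by (auto simp: k_def)
  have fP: "nb_walk G (f # P)"
  proof -
    have "follows f (hd P)" if "P \<noteq> []"
    proof -
      have d: "hd P \<in> darts G" "src (hd P) \<in> B" "tgt (hd P) \<in> B" "src (hd P) = tgt f"
        using P k(2) hd_in_set[OF that] that f(3) by (auto simp: nb_walk_def inside_def joins_def)
      have "edge f \<noteq> edge (hd P)"
      proof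
        assume "edge f = edge (hd P)"
        then have "{src f, tgt f} = {src (hd P), tgt (hd P)}" using d(1) f(1) by (simp add: darts_def)
        then show False using d(2,3) f(2) by (auto simp: doubleton_eq_iff)
      qed
      then show ?thesis using d(4) by (simp add: follows_def)
    qed
    then show ?thesis using P(1) f(1) by (simp add: nb_walk_Cons)
  qed
  have fS: "src f \<notin> ?S" using SB f(2) by blast
  show thesis
  proof (cases "l - l div 2 \<le> k")
    case True
    note Z = approach_walk_down[OF T l mid f(1) fS fP P(2) k(2) P(3) k(1) True]
    let ?Z = "P @ rev_walk (window l T k)"
    show thesis
    proof (rule that[of ?Z k])
      show "inside C ?Z" if "B \<subseteq> C" "inside C T" for C
        using inside_mono[OF P(2) that(1)] inside_window[OF that(2)] by simp
      show "vtx ?Z r \<in> B" if "r \<le> length ?Z - l div 2" for r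
        using Z(3)[of r] that Z(2) by simp
    qed (use Z True k in auto)
  next
    case False
    let ?T = "rev_walk T" and ?k = "l - k"
    have neT: "T \<noteq> []" using T(2) l by auto
    have vT: "vtx ?T i = vtx T (3 * l - i)" if "i \<le> 3 * l" for i
      using vtx_rev_walk[OF T(1) neT] that T(2) by simp
    have "vtx ?T ` {l..2 * l} = vtx T ` ((\<lambda>i. 3 * l - i) ` {l..2 * l})"
      unfolding image_image by (intro image_cong) (auto simp: vT)
    also have "(\<lambda>i. 3 * l - i) ` {l..2 * l} = {l..2 * l}"
    proof
      have "i \<in> (\<lambda>i. 3 * l - i) ` {l..2 * l}" if "i \<in> {l..2 * l}" for i
        using that by (intro image_eqI[of _ _ "3 * l - i"]) auto
      then show "{l..2 * l} \<subseteq> (\<lambda>i. 3 * l - i) ` {l..2 * l}" by (rule subsetI)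
    qed auto
    finally have S: "vtx ?T ` {l..2 * l} = ?S" .
    have mid': "vtx ?T i \<in> B" if "l \<le> i" "i \<le> 2 * l" for i
      using vT[of i] mid[of "3 * l - i"] that by simp
    have join': "joins (tgt f) P (vtx ?T (l + ?k))"
      using k vT[of "l + ?k"] by simp
    have k'': "?k \<le> l" "l - l div 2 \<le> ?k" using False k(1) by auto
    note Z = approach_walk_down[of G ?T l B f P ?k, unfolded S, OF _ _ l mid' f(1) fS fP P(2) join' P(3) k'']
    let ?Z = "P @ rev_walk (window l ?T ?k)"
    have W: "rev_walk (window l ?T ?k) = window l T (l + k)"
      using window_rev_walk[of ?k l T] T(2) k(1) by simp
    show thesis
    proof (rule that[of ?Z "l + k"])
      show "inside C ?Z" if "B \<subseteq> C" "inside C T" for C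
        using inside_mono[OF P(2) that(1)] inside_window[OF that(2)] unfolding W by simp
      show "vtx ?Z r \<in> B" if "r \<le> length ?Z - l div 2" for r
        using Z(3)[of r] that Z(2) T by simp
    qed (use Z T W False k in auto)
  qed
qed


section \<open>Small cliques and the degeneracy\<close>

lemma connected_in_singleton: "connected_in G {x}"
  by (simp add: connected_in_def)

lemma clique_model_edge:
  assumes "multigraph G" "e \<in> edges G"
  shows "\<exists>B. clique_model G {..<2::nat} B"
proof -
  have "card (ends G e) = 2" "ends G e \<subseteq> verts G"
    using assms by (auto simp: multigraph_def)
  then obtain x y where xy: "ends G e = {x, y}" "x \<noteq> y" "x \<in> verts G" "y \<in> verts G"
    by (auto simp: card_2_iff)
  have "clique_model G {..<2} (\<lambda>i::nat. if i = 0 then {x} else {y})"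
    unfolding clique_model_def
  proof (intro conjI ballI impI)
    fix i j :: nat
    assume ij: "i \<in> {..<2}" "j \<in> {..<2}" "i \<noteq> j"
    have "i = 0 \<and> j = 1 \<or> i = 1 \<and> j = 0" using ij by auto
    moreover have "ends G e = {y, x}" using xy(1) by (simp add: insert_commute)
    ultimately show "\<exists>e\<in>edges G. \<exists>u\<in>if i = 0 then {x} else {y}. \<exists>w\<in>if j = 0 then {x} else {y}. ends G e = {u, w}"
      using assms(2) xy(1) by (intro bexI[of _ e]) auto
  qed (use xy in \<open>auto simp: connected_in_singleton\<close>)
  then show ?thesis by blast
qed

text \<open>A complete bipartite graph with \<open>d - 1\<close> vertices on either side contains a clique on \<open>d\<close> branch
  sets: a perfect matching is contracted, except for one of its edges.\<close>

lemma clique_model_bipartite: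
  fixes A C :: "nat \<Rightarrow> 'v"
  defines "I \<equiv> \<lambda>d. {..<d} - {d - 1 :: nat}" and "J \<equiv> \<lambda>d. {..<d} - {d - 2 :: nat}"
  assumes d: "d \<ge> 2" and inj: "inj_on A (I d)" "inj_on C (J d)"
    and verts: "A ` I d \<subseteq> verts G" "C ` J d \<subseteq> verts G"
    and edge: "\<And>i j. i \<in> I d \<Longrightarrow> j \<in> J d \<Longrightarrow> A i \<noteq> C j \<and> (\<exists>e\<in>edges G. ends G e = {A i, C j})"
  shows "\<exists>B. clique_model G {..<d} B"
proof -
  define B where "B i = (if i \<in> I d then {A i} else {}) \<union> (if i \<in> J d then {C i} else {})" for i
  have IJ: "i \<in> I d \<or> i \<in> J d" if "i < d" for i
    using that d by (auto simp: I_def J_def)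
  have "clique_model G {..<d} B"
    unfolding clique_model_def
  proof (intro conjI ballI impI)
    fix i assume i: "i \<in> {..<d}"
    show "B i \<noteq> {}" using IJ[of i] i by (auto simp: B_def)
    show "B i \<subseteq> verts G" using verts by (auto simp: B_def)
    show "connected_in G (B i)"
    proof (cases "i \<in> I d \<and> i \<in> J d")
      case True
      then obtain e where "e \<in> edges G" "ends G e = {A i, C i}" using edge by blast
      then have "connected_in G ({A i} \<union> {C i})"
        by (intro connected_in_Un[of G _ _ "A i" "C i"]) (auto simp: connected_in_singleton)
      then show ?thesis using True by (simp add: B_def)
    next
      case False
      then show ?thesis by (auto simp: B_def connected_in_singleton connected_in_def)
    qed
    fix j assume j: "j \<in> {..<d}" "i \<noteq> j"
    show "B i \<inter> B j = {}"
      using inj edge[of i j] edge[of j i] j(2) by (auto simp: B_def inj_on_def)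
    have "(i \<in> I d \<and> j \<in> J d) \<or> (j \<in> I d \<and> i \<in> J d)"
      using i j by (auto simp: I_def J_def)
    then show "\<exists>e\<in>edges G. \<exists>x\<in>B i. \<exists>y\<in>B j. ends G e = {x, y}"
    proof
      assume ij: "i \<in> I d \<and> j \<in> J d"
      then obtain e where "e \<in> edges G" "ends G e = {A i, C j}" using edge by blast
      moreover have "A i \<in> B i" "C j \<in> B j" using ij by (simp_all add: B_def)
      ultimately show ?thesis by (meson bexI)
    next
      assume ij: "j \<in> I d \<and> i \<in> J d"
      then obtain e where "e \<in> edges G" "ends G e = {A j, C i}" using edge by blast
      then have "e \<in> edges G" "ends G e = {C i, A j}" by (simp_all add: insert_commute)
      moreover have "C i \<in> B i" "A j \<in> B j" using ij by (simp_all add: B_def)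
      ultimately show ?thesis by (meson bexI)
    qed
  qed
  then show ?thesis by blast
qed

text \<open>A lower bound on a degree becomes a supply of edges by which a walk with end vertex \<open>v\<close> can be
  prolonged; its own edge at \<open>v\<close> is put into \<open>X\<close>.\<close>

lemma distinct_darts_into:
  assumes H: "subgraph H G" "v \<in> verts H" and J: "finite J" "card J \<le> card {e\<in>edges H. v \<in> ends H e \<and> e \<notin> X}"
  shows "\<exists>a. inj_on (\<lambda>j. edge (a j)) J \<and> (\<forall>j\<in>J. a j \<in> darts G \<and> tgt (a j) = v \<and> edge (a j) \<notin> X)"
proof -
  let ?E = "{e\<in>edges H. v \<in> ends H e \<and> e \<notin> X}"
  have "finite ?E" using H(1) by (auto simp: subgraph_def multigraph_def)
  then obtain g where g: "g ` J \<subseteq> ?E" "inj_on g J" using card_le_inj[OF J(1) _ J(2)] by blast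
  have "\<exists>u. (u, e, v) \<in> darts G" if "e \<in> ?E" for e
  proof -
    have e: "e \<in> edges H" "v \<in> ends H e" using that by auto
    have "card (ends H e) = 2" using H(1) e(1) by (auto simp: subgraph_def multigraph_def)
    then obtain a b where "ends H e = {a, b}" by (auto simp: card_2_iff)
    then obtain u where "ends H e = {u, v}" using e(2) by auto
    then show ?thesis using H(1) e(1) by (auto simp: darts_def subgraph_def)
  qed
  then have "\<forall>e\<in>?E. \<exists>u. (u, e, v) \<in> darts G" by (intro ballI)
  then obtain u where u: "\<And>e. e \<in> ?E \<Longrightarrow> (u e, e, v) \<in> darts G" unfolding bchoice_iff by (elim exE) (rule that, rule bspec)
  have gE: "g j \<in> ?E" if "j \<in> J" for j using g(1) that by (rule image_subset_iff[THEN iffD1, THEN bspec])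
  show ?thesis
  proof (intro exI[of _ "\<lambda>j. (u (g j), g j, v)"] conjI ballI)
    show "inj_on (\<lambda>j. edge (u (g j), g j, v)) J" using g(2) by simp
    show "(u (g j), g j, v) \<in> darts G" if "j \<in> J" for j by (rule u[OF gE[OF that]])
    show "edge (u (g j), g j, v) \<notin> X" if "j \<in> J" for j using gE[OF that] by simp
  qed simp
qed

text \<open>A walk \<open>R\<close> of length \<open>l - 1\<close> can be prolonged at either end by at least \<open>d - 1\<close> edges. An extension
  at the front and one at the back differ by a single shift, so these links span a complete
  bipartite graph; for \<open>l = 1\<close> the two ends of \<open>R\<close> coincide and the links at a vertex form a clique.\<close>

lemma min_degree_clique_model:
  assumes G: "multigraph G" and l: "l \<ge> 1" and H: "subgraph H G" "verts H \<noteq> {}"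
    and d: "3 \<le> d" "d \<le> min_degree H"
  shows "\<exists>B. clique_model (link_graph l G) {..<d} B"
proof -
  have finH: "finite (verts H)" "finite (edges H)" using H(1) by (auto simp: subgraph_def multigraph_def)
  have deg: "d \<le> card {e\<in>edges H. v \<in> ends H e}" if "v \<in> verts H" for v
    using d(2) that finH(1) unfolding min_degree_def degree_def[symmetric]
    by (meson Min_le finite_imageI imageI le_trans)
  have deg': "d - 1 \<le> card {e\<in>edges H. v \<in> ends H e \<and> e \<notin> {f}}" if "v \<in> verts H" for v f
  proof -
    have "{e\<in>edges H. v \<in> ends H e \<and> e \<notin> {f}} = {e\<in>edges H. v \<in> ends H e} - {f}" by auto
    then show ?thesis
      using deg[OF that] diff_card_le_card_Diff[of "{f}" "{e\<in>edges H. v \<in> ends H e}"] by simp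
  qed
  show ?thesis
  proof (cases "l = 1")
    case True
    obtain v where v: "v \<in> verts H" using H(2) by blast
    obtain a where a: "inj_on (\<lambda>j. edge (a j)) {..<d}" "\<And>j. j < d \<Longrightarrow> a j \<in> darts G \<and> tgt (a j) = v"
      using distinct_darts_into[OF H(1) v, of "{..<d}" "{}"] deg[OF v] by auto
    have nb: "nb_walk G [a i]" if "i < d" for i using a(2)[OF that] by (simp add: nb_walk_Cons)
    have "clique_model (link_graph l G) {..<d} (\<lambda>i. {walk_link [a i]})"
      unfolding clique_model_def
    proof (intro conjI ballI impI)
      fix i assume i: "i \<in> {..<d}"
      show "{walk_link [a i]} \<subseteq> verts (link_graph l G)"
        using walk_link_in_links[OF G nb, of i] i True by (simp add: link_graph_def)
      fix j assume j: "j \<in> {..<d}" "i \<noteq> j"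
      have ne: "edge (a i) \<noteq> edge (a j)" using a(1) i j by (auto simp: inj_on_def)
      let ?z = "[a i, flip (a j)]"
      have z: "nb_walk G ?z" using a(2)[of i] a(2)[of j] i j ne by (simp add: nb_walk_Cons follows_def)
      have rev: "walk_link [flip (a j)] = walk_link [a j]"
        using walk_link_rev_walk[OF nb[of j]] j by simp
      show "{walk_link [a i]} \<inter> {walk_link [a j]} = {}"
        using shunt_edge(3)[OF G z _ l] True rev by simp
      show "\<exists>e\<in>edges (link_graph l G). \<exists>x\<in>{walk_link [a i]}. \<exists>y\<in>{walk_link [a j]}. ends (link_graph l G) e = {x, y}"
        using shunt_edge(1,2)[OF G z _ l] True rev
        by (intro bexI[of _ "walk_link ?z"] bexI[OF _ singletonI]) simp_all
    qed (simp_all add: connected_in_singleton)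
    then show ?thesis by blast
  next
    case False
    have "branching G (verts H)"
      unfolding branching_def
    proof (intro ballI allI)
      fix v f assume v: "v \<in> verts H"
      have "card {e\<in>edges H. v \<in> ends H e \<and> e \<notin> {f}} \<noteq> 0" using deg'[OF v, of f] d(1) by linarith
      then have "{e\<in>edges H. v \<in> ends H e \<and> e \<notin> {f}} \<noteq> {}" by (metis card.empty)
      then obtain e where e: "e \<in> edges H" "v \<in> ends H e" "e \<noteq> f" by blast
      moreover have "ends G e = ends H e" "ends H e \<subseteq> verts H" "edges H \<subseteq> edges G"
        using H(1) e(1) unfolding subgraph_def multigraph_def by metis+
      ultimately show "\<exists>e'\<in>edges G. e' \<noteq> f \<and> v \<in> ends G e' \<and> ends G e' \<subseteq> verts H"
        by (intro bexI[of _ e]) auto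
    qed
    then obtain R where R: "length R = l - 1" "nb_walk G R" "inside (verts H) R"
      using long_nb_walk[OF G _ H(2)] by blast
    have neR: "R \<noteq> []" using R(1) l False by auto
    let ?I = "{..<d} - {d - 1}" and ?J = "{..<d} - {d - 2}"
    have cardIJ: "card ?I \<le> d - 1" "card ?J \<le> d - 1" using d(1) by auto
    have finI: "finite ?I" "finite ?J" by simp_all
    have endR: "src (hd R) \<in> verts H" "tgt (last R) \<in> verts H"
      using R(3) neR by (auto simp: inside_def)
    obtain a where a: "inj_on (\<lambda>j. edge (a j)) ?I"
      "\<And>j. j \<in> ?I \<Longrightarrow> a j \<in> darts G \<and> tgt (a j) = src (hd R) \<and> edge (a j) \<notin> {edge (hd R)}"
      using distinct_darts_into[OF H(1) endR(1) finI(1) le_trans[OF cardIJ(1) deg'[OF endR(1), of "edge (hd R)"]]]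
      by (elim exE conjE) (erule that, erule bspec)
    obtain c where c: "inj_on (\<lambda>j. edge (c j)) ?J"
      "\<And>j. j \<in> ?J \<Longrightarrow> c j \<in> darts G \<and> tgt (c j) = tgt (last R) \<and> edge (c j) \<notin> {edge (last R)}"
      using distinct_darts_into[OF H(1) endR(2) finI(2) le_trans[OF cardIJ(2) deg'[OF endR(2), of "edge (last R)"]]]
      by (elim exE conjE) (erule that, erule bspec)
    let ?A = "\<lambda>i. a i # R" and ?C = "\<lambda>i. R @ [flip (c i)]"
    have A: "nb_walk G (?A i)" if "i \<in> ?I" for i
      using a(2)[OF that] R(2) by (simp add: nb_walk_Cons follows_def)
    have C: "nb_walk G (?C i)" if "i \<in> ?J" for i
      using c(2)[OF that] R(2) by (auto simp: nb_walk_append nb_walk_Cons follows_def)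
    have AC: "nb_walk G (a i # R @ [flip (c j)])" if "i \<in> ?I" "j \<in> ?J" for i j
      using a(2)[OF that(1)] C[OF that(2)] neR by (simp add: nb_walk_Cons follows_def)
    have injA: "inj_on (\<lambda>i. walk_link (?A i)) ?I"
    proof (rule inj_onI)
      fix i j assume ij: "i \<in> ?I" "j \<in> ?I" "walk_link (?A i) = walk_link (?A j)"
      have "edge (a i) = edge (a j)"
        using walk_link_eqD[OF A[OF ij(1)] A[OF ij(2)] list.distinct(2) list.distinct(2) ij(3)]
      proof (elim disjE)
        assume "?A i = rev_walk (?A j)"
        then have "hd (?A i) = hd (rev_walk (?A j))" "last (?A i) = last (rev_walk (?A j))" by metis+
        then have "a i = flip (last R)" "last R = flip (a j)"
          using neR by (simp_all add: hd_rev_walk hd_append)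
        then show ?thesis by simp
      qed simp_all
      then show "i = j" using inj_onD[OF a(1) _ ij(1,2)] by simp
    qed
    have injC: "inj_on (\<lambda>i. walk_link (?C i)) ?J"
    proof (rule inj_onI)
      fix i j assume ij: "i \<in> ?J" "j \<in> ?J" "walk_link (?C i) = walk_link (?C j)"
      have ne: "R @ [x] \<noteq> []" for x by simp
      have "edge (c i) = edge (c j)"
        using walk_link_eqD[OF C[OF ij(1)] C[OF ij(2)] ne ne ij(3)]
      proof (elim disjE)
        assume "?C i = rev_walk (?C j)"
        then have "hd (?C i) = hd (rev_walk (?C j))" "last (?C i) = last (rev_walk (?C j))" by metis+
        then have "hd R = c j" "flip (c i) = flip (hd R)"
          using neR by (simp_all add: last_rev_walk)
        then show ?thesis by (metis flip_simps(3))
      qed (simp add: flip_def)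
      then show "i = j" using inj_onD[OF c(1) _ ij(1,2)] by simp
    qed
    show ?thesis
    proof (rule clique_model_bipartite[OF _ injA injC])
      show "2 \<le> d" using d(1) by simp
      show "(\<lambda>i. walk_link (?A i)) ` ?I \<subseteq> verts (link_graph l G)"
        using walk_link_in_links[OF G A] R(1) l by (auto simp: link_graph_def)
      show "(\<lambda>i. walk_link (?C i)) ` ?J \<subseteq> verts (link_graph l G)"
        using walk_link_in_links[OF G C] R(1) l by (auto simp: link_graph_def)
      fix i j assume ij: "i \<in> ?I" "j \<in> ?J"
      let ?z = "a i # R @ [flip (c j)]"
      have len: "length ?z = l + 1" using R(1) l by simp
      have "butlast ?z = ?A i" "tl ?z = ?C j" by (simp_all add: butlast_append)
      then show "walk_link (?A i) \<noteq> walk_link (?C j) \<and>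
          (\<exists>e\<in>edges (link_graph l G). ends (link_graph l G) e = {walk_link (?A i), walk_link (?C j)})"
        using shunt_edge[OF G AC[OF ij] len l] by (metis bexI)
    qed
  qed
qed


section \<open>Three branch sets: a link running round a cycle\<close>

text \<open>For odd \<open>l\<close> the middle of a link is an edge, possibly between two branch sets. On the cycle such
  an edge is given to the branch set that the cycle is leaving, so that each of the three sets owns
  at least one edge. A minimum would leave nothing to the last set if it is a single vertex.\<close>

definition cyclic_choice :: "nat \<Rightarrow> nat \<Rightarrow> nat" where
  "cyclic_choice a b = (if a = b then a else if {a, b} = {0, 2} then 2 else min a b)"

lemma cyclic_choice_simps [simp]:
  "cyclic_choice a a = a" "cyclic_choice 0 (Suc 0) = 0" "cyclic_choice (Suc 0) 2 = Suc 0" "cyclic_choice 2 0 = 2"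
  by (auto simp: cyclic_choice_def doubleton_eq_iff)

lemma cyclic_choice_commute: "cyclic_choice a b = cyclic_choice b a"
  by (auto simp: cyclic_choice_def min_def insert_commute)

lemma middle_rev_walk:
  assumes "nb_walk G xs" "length xs = l" "l \<ge> 1"
  shows "vtx (rev_walk xs) (l div 2) = vtx xs (l - l div 2)"
    and "vtx (rev_walk xs) (l - l div 2) = vtx xs (l div 2)"
proof -
  have "xs \<noteq> []" using assms(2,3) by auto
  then show "vtx (rev_walk xs) (l div 2) = vtx xs (l - l div 2)"
    "vtx (rev_walk xs) (l - l div 2) = vtx xs (l div 2)"
    using vtx_rev_walk[OF assms(1)] assms(2) by simp_all
qed

lemma middle_window:
  assumes "nb_walk G xs" "s + l \<le> length xs" "l \<ge> 1"
  shows "vtx (window l xs s) (l div 2) = vtx xs (s + l div 2)"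
    and "vtx (window l xs s) (l - l div 2) = vtx xs (s + (l - l div 2))"
  using assms by (intro vtx_window; simp)+

text \<open>The walk \<open>C0 @ C1 @ C2\<close> closes up, so a link of any length can run along its periodic continuation.
  Its middle visits the three blocks in turn and returns to the same link after one period.\<close>

lemma clique_model_cyclic:
  fixes idx :: "'v \<Rightarrow> nat" and G :: "('v, 'e) mgraph"
  assumes G: "multigraph G" and l: "l \<ge> 1"
    and nb: "nb_walk G (C0 @ C1 @ C2)" "follows (last C2) (hd C0)"
    and ne: "C0 \<noteq> []" "C1 \<noteq> []" "C2 \<noteq> []"
    and idx: "\<And>d. d \<in> set C0 \<Longrightarrow> idx (src d) = 0" "\<And>d. d \<in> set C1 \<Longrightarrow> idx (src d) = 1"
      "\<And>d. d \<in> set C2 \<Longrightarrow> idx (src d) = 2"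
  shows "\<exists>B. clique_model (link_graph l G) {..<3::nat} B"
proof -
  define c where "c = C0 @ C1 @ C2"
  define n where "n = length c"
  define a1 where "a1 = length C0"
  define a2 where "a2 = length C0 + length C1"
  have a: "0 < a1" "a1 < a2" "a2 < n" using ne by (simp_all add: a1_def a2_def n_def c_def)
  define \<gamma> where "\<gamma> m = (if m < a1 then 0 else if m < a2 then 1 else 2::nat)" for m
  have \<gamma>: "idx (src (c ! m)) = \<gamma> m" if "m < n" for m
    using that idx by (auto simp: c_def n_def \<gamma>_def a1_def a2_def nth_append)
  \<comment> \<open>Windows are addressed by the position of their middle; starting at a multiple \<open>N \<ge> l\<close> of the period
    keeps all the start positions \<open>N + a - p\<close> natural numbers.\<close>
  define N where "N = n * l"
  define M where "M = N + n + l + 1"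
  define \<tau> where "\<tau> = map (\<lambda>r. c ! (r mod n)) [0..<M]"
  have n0: "n > 0" using a by simp
  have len: "length \<tau> = M" by (simp add: \<tau>_def)
  have nth: "\<tau> ! r = c ! (r mod n)" if "r < M" for r using that by (simp add: \<tau>_def)
  have nbc: "nb_walk G c" using nb(1) by (simp add: c_def)
  have wrap: "follows (c ! (n - 1)) (c ! 0)"
  proof -
    have "c \<noteq> []" "last c = last C2" "hd c = hd C0" using ne by (simp_all add: c_def)
    then show ?thesis using nb(2) last_conv_nth[of c] hd_conv_nth[of c] by (simp add: n_def)
  qed
  have nb\<tau>: "nb_walk G \<tau>"
    unfolding nb_walk_def successively_conv_nth
  proof (intro conjI allI impI)
    have "c ! (r mod n) \<in> darts G" for r
      using nbc nth_mem[of "r mod n" c] n0 unfolding nb_walk_def n_def by auto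
    then show "set \<tau> \<subseteq> darts G" by (auto simp: \<tau>_def)
    fix r assume "Suc r < length \<tau>"
    then have r: "Suc r < M" by (simp add: len)
    have "follows (c ! (r mod n)) (c ! (Suc r mod n))"
    proof (cases "Suc (r mod n) = n")
      case True
      then have "Suc r mod n = 0" "r mod n = n - 1" by (simp_all add: mod_Suc)
      then show ?thesis using wrap by simp
    next
      case False
      then have "Suc r mod n = Suc (r mod n)" "Suc (r mod n) < length c"
        using mod_less_divisor[OF n0, of r] by (simp_all add: mod_Suc n_def)
      then show ?thesis using nbc by (simp add: nb_walk_def successively_nth)
    qed
    then show "follows (\<tau> ! r) (\<tau> ! Suc r)" using r by (simp add: nth)
  qed
  have col: "idx (vtx \<tau> r) = \<gamma> (r mod n)" if "r < M" for r
    using vtx_nth[OF nb\<tau>, of r] that \<gamma>[of "r mod n"] n0 by (simp add: len nth)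
  \<comment> \<open>The middle of a window is one vertex or two consecutive ones, and the label only sees the first.\<close>
  have step: "cyclic_choice (\<gamma> (r mod n)) (\<gamma> (Suc r mod n)) = \<gamma> (r mod n)" for r
  proof (cases "Suc (r mod n) = n")
    case True
    then have "Suc r mod n = 0" "r mod n \<ge> a2" using a by (simp_all add: mod_Suc)
    then show ?thesis using a by (simp add: \<gamma>_def)
  next
    case False
    then have "Suc r mod n = Suc (r mod n)" by (simp add: mod_Suc)
    moreover have "\<gamma> (Suc m) = \<gamma> m \<or> \<gamma> m = 0 \<and> \<gamma> (Suc m) = 1 \<or> \<gamma> m = 1 \<and> \<gamma> (Suc m) = 2" for m
      using a by (auto simp: \<gamma>_def)
    ultimately show ?thesis by (metis cyclic_choice_simps(1-3) One_nat_def)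
  qed
  define p where "p = l div 2"
  define h where "h xs = cyclic_choice (idx (vtx xs p)) (idx (vtx xs (l - p)))" for xs :: "('v, 'e) dart list"
  have hrev: "h (rev_walk xs) = h xs" if "nb_walk G xs" "length xs = l" for xs
    using middle_rev_walk[OF that l] by (simp add: h_def p_def cyclic_choice_commute)
  have lab: "h (window l \<tau> s) = \<gamma> ((s + p) mod n)" if s: "s + l < M" for s
  proof -
    have "h (window l \<tau> s) = cyclic_choice (\<gamma> ((s + p) mod n)) (\<gamma> ((s + (l - p)) mod n))"
      using middle_window[OF nb\<tau> _ l, of s] s col[of "s + p"] col[of "s + (l - p)"]
      by (simp add: h_def p_def len)
    moreover have "l - p = p \<or> l - p = Suc p" unfolding p_def by presburger
    ultimately show ?thesis using step[of "s + p"] by auto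
  qed
  have Np: "p \<le> N"
  proof -
    have "1 * l \<le> n * l" using n0 by (intro mult_le_mono1) simp
    then show ?thesis unfolding N_def p_def by linarith
  qed
  have lab': "h (window l \<tau> s) = \<gamma> (s + p - N)" if "N - p \<le> s" "s + p < N + n" for s
  proof -
    define j where "j = s + p - N"
    have j: "s + p = N + j" "j < n" using that Np by (auto simp: j_def)
    have "(s + p) mod n = j" using j by (simp add: N_def)
    then show ?thesis using lab[of s] that Np by (simp add: j_def M_def p_def)
  qed
  have period: "window l \<tau> (N + n - p) = window l \<tau> (N - p)"
  proof (rule nth_equalityI)
    show "length (window l \<tau> (N + n - p)) = length (window l \<tau> (N - p))"
      using Np by (simp add: len M_def)
    fix k assume "k < length (window l \<tau> (N + n - p))"
    then have k: "k < l" by (simp add: window_def)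
    have "N + n - p + k = (N - p + k) + n" using Np by simp
    then have "(N + n - p + k) mod n = (N - p + k) mod n" by (metis mod_add_self2)
    then show "window l \<tau> (N + n - p) ! k = window l \<tau> (N - p) ! k"
      using k Np by (simp add: nth_window nth len M_def)
  qed
  define b where "b i = window l \<tau> (N + (if i = 0 then 0 else if i = 1 then a1 else a2) - p)" for i :: nat
  have b: "nb_walk G (b i) \<and> length (b i) = l \<and> h (b i) = i" if "i < 3" for i
  proof -
    have i: "i = 0 \<or> i = 1 \<or> i = 2" using that by auto
    have "length (b i) = l" using Np a by (simp add: b_def len M_def)
    moreover have "h (b i) = i"
      using i lab'[of "N - p"] lab'[of "N + a1 - p"] lab'[of "N + a2 - p"] Np a
      by (auto simp: b_def \<gamma>_def)
    ultimately show ?thesis using nb_walk_window[OF nb\<tau>] by (simp add: b_def)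
  qed
  have adj01: "adjacent_slides G l h b 0 1"
  proof (rule adjacent_slides_window[OF nb\<tau>, of "N - p" "N + a1 - 1 - p" "N + a1 - p"])
    show "h (window l \<tau> s) = 0" if "N - p \<le> s" "s \<le> N + a1 - 1 - p" for s
      using lab'[of s] that a Np by (simp add: \<gamma>_def)
    show "h (window l \<tau> s) = 1" if "N + a1 - 1 - p < s" "s \<le> N + a1 - p" for s
    proof -
      have "s = N + a1 - p" using that a Np by linarith
      then show ?thesis using lab'[of s] a Np by (simp add: \<gamma>_def)
    qed
  qed (use a Np in \<open>simp_all add: b_def len M_def\<close>)
  have adj12: "adjacent_slides G l h b 1 2"
  proof (rule adjacent_slides_window[OF nb\<tau>, of "N + a1 - p" "N + a2 - 1 - p" "N + a2 - p"])
    show "h (window l \<tau> s) = 1" if "N + a1 - p \<le> s" "s \<le> N + a2 - 1 - p" for s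
    proof -
      have "a1 \<le> s + p - N" "s + p - N < a2" "N - p \<le> s" "s + p < N + n" using that a Np by linarith+
      then show ?thesis using lab'[of s] by (simp add: \<gamma>_def)
    qed
    show "h (window l \<tau> s) = 2" if "N + a2 - 1 - p < s" "s \<le> N + a2 - p" for s
    proof -
      have "s = N + a2 - p" using that a Np by linarith
      then show ?thesis using lab'[of s] a Np by (simp add: \<gamma>_def)
    qed
  qed (use a Np in \<open>simp_all add: b_def len M_def\<close>)
  have adj20: "adjacent_slides G l h b 2 0"
  proof (rule adjacent_slides_window[OF nb\<tau>, of "N + a2 - p" "N + n - 1 - p" "N + n - p"])
    show "h (window l \<tau> s) = 2" if "N + a2 - p \<le> s" "s \<le> N + n - 1 - p" for s
    proof -
      have "a2 \<le> s + p - N" "N - p \<le> s" "s + p < N + n" using that a Np by linarith+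
      then show ?thesis using lab'[of s] a by (simp add: \<gamma>_def)
    qed
    show "h (window l \<tau> s) = 0" if "N + n - 1 - p < s" "s \<le> N + n - p" for s
    proof -
      have "s = N + n - p" using that a Np by simp
      then show ?thesis using period b[of 0] by (simp add: b_def)
    qed
  qed (use a Np period in \<open>simp_all add: b_def len M_def\<close>)
  have "clique_model (link_graph l G) {..<3} (\<lambda>i. walk_link ` {x. slides_to G l h i (b i) x})"
  proof (rule clique_model_of_slides[OF G l])
    fix i j :: nat assume "i < j" "j < 3"
    then have "i = 0 \<and> j = 1 \<or> i = 1 \<and> j = 2 \<or> i = 0 \<and> j = 2" by auto
    then show "adjacent_slides G l h b i j \<or> adjacent_slides G l h b j i"
      using adj01 adj12 adj20 by auto
  qed (use hrev b in auto)
  then show ?thesis by blast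
qed

lemma dart_between:
  assumes "clique_model G I B" "i \<in> I" "j \<in> I" "i \<noteq> j"
  obtains d where "d \<in> darts G" "src d \<in> B i" "tgt d \<in> B j"
proof -
  obtain e x y where "e \<in> edges G" "x \<in> B i" "y \<in> B j" "ends G e = {x, y}"
    using clique_model_touch[OF assms] .
  then show thesis using that[of "(x, e, y)"] by (simp add: darts_def)
qed

lemma edge_neq_of_index:
  assumes "d \<in> darts G" "d' \<in> darts G" "{idx (src d), idx (tgt d)} \<noteq> {idx (src d'), idx (tgt d')}"
  shows "edge d \<noteq> edge d'"
proof
  assume "edge d = edge d'"
  then have "{src d, tgt d} = {src d', tgt d'}" using assms(1,2) by (simp add: darts_def)
  from arg_cong[OF this, of "\<lambda>A. idx ` A"] show False using assms(3) by simp
qed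

text \<open>The edges between the branch sets, joined by walks inside them, form such a closed walk.\<close>

lemma three_branch_sets:
  fixes G :: "('v, 'e) mgraph"
  assumes G: "multigraph G" and l: "l \<ge> 1" and model: "clique_model G {..<3::nat} B"
  shows "\<exists>B'. clique_model (link_graph l G) {..<3::nat} B'"
proof -
  obtain idx :: "'v \<Rightarrow> nat" where idx: "\<And>i v. i < 3 \<Longrightarrow> v \<in> B i \<Longrightarrow> idx v = i"
    using clique_model_index[OF model] by blast
  have conn: "connected_in G (B i)" if "i < 3" for i using model that by (simp add: clique_model_def)
  obtain f0 where f0: "f0 \<in> darts G" "src f0 \<in> B 0" "tgt f0 \<in> B 1"
    using dart_between[OF model, of 0 1] by auto
  obtain f1 where f1: "f1 \<in> darts G" "src f1 \<in> B 1" "tgt f1 \<in> B 2"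
    using dart_between[OF model, of 1 2] by auto
  obtain f2 where f2: "f2 \<in> darts G" "src f2 \<in> B 2" "tgt f2 \<in> B 0"
    using dart_between[OF model, of 2 0] by auto
  have block: "\<exists>C. nb_walk G C \<and> C \<noteq> [] \<and> last C = f' \<and> follows f (hd C) \<and> (\<forall>d\<in>set C. idx (src d) = i)"
    if i: "i < 3" and f: "f \<in> darts G" "tgt f \<in> B i" "idx (src f) \<noteq> i"
      and f': "f' \<in> darts G" "src f' \<in> B i" "idx (tgt f') \<noteq> i" "idx (src f) \<noteq> idx (tgt f')" for i f f'
  proof -
    obtain P where P: "nb_walk G P" "inside (B i) P" "joins (tgt f) P (src f')"
      using connected_in_walk[OF conn[OF i] f(2) f'(2)] .
    have ix: "idx (tgt f) = i" "idx (src f') = i" using idx[OF i] f f' by auto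
    have Pd: "d \<in> darts G \<and> idx (src d) = i \<and> idx (tgt d) = i" if "d \<in> set P" for d
      using P(1,2) that idx[OF i] by (auto simp: nb_walk_def inside_def)
    have ff': "edge f \<noteq> edge f'"
      using ix f f' by (intro edge_neq_of_index[OF f(1) f'(1), of idx]) (auto simp: doubleton_eq_iff)
    have fP: "edge f \<noteq> edge d" if "d \<in> set P" for d
      using ix f Pd[OF that] by (intro edge_neq_of_index[of f G d idx]) (auto simp: doubleton_eq_iff)
    have Pf: "edge d \<noteq> edge f'" if "d \<in> set P" for d
      using ix f' Pd[OF that] by (intro edge_neq_of_index[of d G f' idx]) (auto simp: doubleton_eq_iff)
    have "nb_walk G (P @ [f'])"
      using P(1,3) f'(1) Pf by (auto simp: nb_walk_append nb_walk_Cons follows_def joins_def)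
    moreover have "follows f (hd (P @ [f']))"
      using P(3) fP ff' by (auto simp: follows_def joins_def hd_append)
    ultimately show ?thesis
      using Pd ix by (intro exI[of _ "P @ [f']"]) auto
  qed
  have ix: "idx (src f0) = 0" "idx (tgt f0) = 1" "idx (src f1) = 1" "idx (tgt f1) = 2"
    "idx (src f2) = 2" "idx (tgt f2) = 0"
    using idx f0 f1 f2 by simp_all
  obtain C0 where C0: "nb_walk G C0" "C0 \<noteq> []" "last C0 = f0" "follows f2 (hd C0)" "\<forall>d\<in>set C0. idx (src d) = 0"
    using block[of 0 f2 f0] f0 f2 ix by auto
  obtain C1 where C1: "nb_walk G C1" "C1 \<noteq> []" "last C1 = f1" "follows f0 (hd C1)" "\<forall>d\<in>set C1. idx (src d) = 1"
    using block[of 1 f0 f1] f0 f1 ix by auto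
  obtain C2 where C2: "nb_walk G C2" "C2 \<noteq> []" "last C2 = f2" "follows f1 (hd C2)" "\<forall>d\<in>set C2. idx (src d) = 2"
    using block[of 2 f1 f2] f1 f2 ix by auto
  have "nb_walk G (C0 @ C1 @ C2)" using C0 C1 C2 by (simp add: nb_walk_append)
  then show ?thesis
    using clique_model_cyclic[OF G l, of C0 C1 C2 idx] C0 C1 C2 by simp
qed


section \<open>Branch sets of large diameter: links crossing between branch sets\<close>

lemma slides_to_rev:
  assumes "slides_to G l h i b x" "nb_walk G b" "length b = l" "h b = i"
    and "\<And>xs. nb_walk G xs \<Longrightarrow> length xs = l \<Longrightarrow> h (rev_walk xs) = h xs"
  shows "slides_to G l h i b (rev_walk x)"
proof -
  have "nb_walk G x" "length x = l" "h x = i" using slides_to_label[OF assms(1-4)] by auto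
  then show ?thesis using assms(1,5) slides_to_rev_walk by (metis rtranclp_trans)
qed

text \<open>As \<open>U\<close> is branching, an initial segment of \<open>xs\<close> can be prolonged at both ends, which gives a link
  resting on it room to move in either direction.\<close>

lemma extended_walk:
  assumes G: "multigraph G" and U: "branching G U" "B \<subseteq> U" and l: "l \<ge> 1"
    and xs: "nb_walk G xs" "inside B xs" "l \<le> length xs"
  shows "\<exists>T. nb_walk G T \<and> length T = 3 * l \<and> (\<forall>k. l \<le> k \<longrightarrow> k \<le> 2 * l \<longrightarrow> vtx T k \<in> B)"
proof -
  define D where "D = take l xs"
  have D: "nb_walk G D" "inside B D" "length D = l" "D \<noteq> []"
    using xs l by (auto simp: D_def nb_walk_take inside_take)
  then have DU: "src (hd D) \<in> U" "tgt (last D) \<in> U"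
    using U(2) hd_in_set[OF D(4)] last_in_set[OF D(4)] by (auto simp: inside_def)
  obtain E' where E': "length E' = l" "nb_walk G (D @ E')"
    using nb_walk_extend[OF G U(1) D(1,4) DU(2)] by blast
  have "\<exists>E. length E = l \<and> nb_walk G (rev_walk (D @ E') @ E) \<and> inside U E"
    using E'(2) D(4) DU(1) by (intro nb_walk_extend[OF G U(1)]) (simp_all add: last_rev_walk del: rev_walk_simps(5))
  then obtain E where E: "length E = l" "nb_walk G (rev_walk (D @ E') @ E)" by blast
  define T where "T = rev_walk E @ (D @ E')"
  have T: "nb_walk G T" using E(2) nb_walk_rev_walk[of G T] by (simp add: T_def)
  have "vtx T k \<in> B" if "l \<le> k" "k \<le> 2 * l" for k
  proof -
    have "vtx T k = vtx (D @ E') (k - l)"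
      using vtx_append2[of G "rev_walk E" "D @ E'" "k - l"] T D(4) E(1) that(1) by (simp add: T_def)
    also have "\<dots> = vtx D (k - l)" using D(3,4) that by (intro vtx_append1) simp_all
    finally show ?thesis using inside_vtx[OF D(2,4)] D(3) that by simp
  qed
  moreover have "length T = 3 * l" using E(1) E'(1) D(3) by (simp add: T_def)
  ultimately show ?thesis using T by blast
qed

text \<open>A link belongs to the branch set of its middle vertex or, if its middle is an edge between two
  branch sets, to the one of smaller index. The base link of \<open>B i\<close> is the middle third of a walk \<open>T i\<close>
  of length \<open>3 * l\<close>. A link entering \<open>B i\<close> approaches this walk, follows it into one of its outer
  thirds and then backs up along it onto the middle third; all the while its middle stays in \<open>B i\<close>,
  although its ends may stick out.\<close>

lemma large_branch_sets:
  fixes G :: "('v, 'e) mgraph"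
  assumes G: "multigraph G" and l: "l \<ge> 1" and model: "clique_model G {..<t::nat} B"
    and U: "branching G (\<Union>i<t. B i)"
    and far: "\<And>i. i < t \<Longrightarrow> \<exists>x\<in>B i. \<exists>y\<in>B i. \<forall>xs. nb_walk G xs \<longrightarrow> inside (B i) xs \<longrightarrow> joins x xs y \<longrightarrow> l \<le> length xs"
  shows "\<exists>B'. clique_model (link_graph l G) {..<t} B'"
proof -
  obtain idx :: "'v \<Rightarrow> nat" where idx: "\<And>i v. i < t \<Longrightarrow> v \<in> B i \<Longrightarrow> idx v = i"
    using clique_model_index[OF model] by blast
  have conn: "connected_in G (B i)" if "i < t" for i using model that by (simp add: clique_model_def)
  have "\<exists>T. nb_walk G T \<and> length T = 3 * l \<and> (\<forall>k. l \<le> k \<longrightarrow> k \<le> 2 * l \<longrightarrow> vtx T k \<in> B i)" if i: "i < t" for i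
  proof -
    obtain x y where xy: "x \<in> B i" "y \<in> B i"
      "\<And>xs. nb_walk G xs \<Longrightarrow> inside (B i) xs \<Longrightarrow> joins x xs y \<Longrightarrow> l \<le> length xs"
      using far[OF i] by metis
    obtain xs where xs: "nb_walk G xs" "inside (B i) xs" "joins x xs y"
      using connected_in_walk[OF conn[OF i] xy(1,2)] .
    show ?thesis
      by (rule extended_walk[OF G U _ l xs(1,2) xy(3)[OF xs]]) (use i in auto)
  qed
  then obtain T where T: "\<And>i. i < t \<Longrightarrow> nb_walk G (T i)" "\<And>i. i < t \<Longrightarrow> length (T i) = 3 * l"
    and mid: "\<And>i k. i < t \<Longrightarrow> l \<le> k \<Longrightarrow> k \<le> 2 * l \<Longrightarrow> vtx (T i) k \<in> B i"
    by metis
  define p where "p = l div 2"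
  have p: "p \<le> l - p" "l - p \<le> l" "p \<le> l" by (auto simp: p_def)
  define h where "h xs = min (idx (vtx xs p)) (idx (vtx xs (l - p)))" for xs :: "('v, 'e) dart list"
  have hrev: "h (rev_walk xs) = h xs" if "nb_walk G xs" "length xs = l" for xs
    using middle_rev_walk[OF that l] by (simp add: h_def p_def min.commute)
  have hwin: "h (window l xs s) = min (idx (vtx xs (s + p))) (idx (vtx xs (s + (l - p))))"
    if "nb_walk G xs" "s + l \<le> length xs" for xs s
    using middle_window[OF that l] by (simp add: h_def p_def)
  have labT: "h (window l (T i) s) = i" if "i < t" "l - p \<le> s" "s \<le> l + p" for i s
  proof -
    have "idx (vtx (T i) (s + p)) = i" "idx (vtx (T i) (s + (l - p))) = i"
      using that p by (auto intro!: idx[OF that(1)] mid[OF that(1)])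
    then show ?thesis using hwin[OF T(1)[OF that(1)], of s] T(2)[OF that(1)] that p by simp
  qed
  define b where "b i = window l (T i) l" for i
  have b: "nb_walk G (b i)" "length (b i) = l" "h (b i) = i" if "i < t" for i
    using that T labT[of i l] p by (simp_all add: b_def nb_walk_window)
  have slideT: "slides_to G l h i (b i) (window l (T i) s)" if "i < t" "l - p \<le> s" "s \<le> l + p" for i s
  proof (cases "s \<le> l")
    case True
    have "slides_to G l h i (window l (T i) s) (b i)"
      unfolding b_def using that True T p by (intro slides_to_window labT) auto
    then show ?thesis by (rule slides_to_sym)
  next
    case False
    then show ?thesis
      unfolding b_def using that T p by (intro slides_to_window labT) auto
  qed
  have slide_rev: "slides_to G l h i (b i) (rev_walk x)" if "i < t" "slides_to G l h i (b i) x" for i x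
    using slides_to_rev[OF that(2) b[OF that(1)] hrev] .
  have gate: "\<exists>Z. nb_walk G (f # Z) \<and> l \<le> length Z \<and> (\<forall>r\<le>length Z - p. vtx Z r \<in> B i) \<and>
      slides_to G l h i (b i) (window l Z (length Z - l))"
    if i: "i < t" and f: "f \<in> darts G" "src f \<notin> B i" "tgt f \<in> B i" for i f
  proof -
    obtain Z s where Z: "nb_walk G (f # Z)" "length Z \<ge> l" "\<And>r. r \<le> length Z - l div 2 \<Longrightarrow> vtx Z r \<in> B i"
      "l - l div 2 \<le> s" "s \<le> l + l div 2"
      "window l Z (length Z - l) \<in> {window l (T i) s, rev_walk (window l (T i) s)}"
      using approach_walk[OF conn[OF i] T[OF i] l mid[OF i] f] by metis
    then have "slides_to G l h i (b i) (window l Z (length Z - l))"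
      using slideT[OF i, of s] slide_rev[OF i] by (auto simp: p_def)
    then show ?thesis using Z(1-3) by (auto simp: p_def)
  qed
  have adj: "adjacent_slides G l h b i j" if ij: "i < j" "j < t" for i j
  proof -
    have it: "i < t" using ij by simp
    obtain f where f: "f \<in> darts G" "src f \<in> B i" "tgt f \<in> B j"
      using dart_between[OF model, of i j] ij by auto
    have nf: "src f \<notin> B j" "tgt f \<notin> B i"
      using f idx[OF it] idx[OF ij(2)] ij(1) by fastforce+
    obtain Z where Z: "nb_walk G (f # Z)" "l \<le> length Z" "\<And>r. r \<le> length Z - p \<Longrightarrow> vtx Z r \<in> B j"
      "slides_to G l h j (b j) (window l Z (length Z - l))"
      using gate[OF ij(2) f(1) nf(1) f(3)] by blast
    obtain Y where Y: "nb_walk G (flip f # Y)" "l \<le> length Y" "\<And>r. r \<le> length Y - p \<Longrightarrow> vtx Y r \<in> B i"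
      "slides_to G l h i (b i) (window l Y (length Y - l))"
      using gate[OF it, of "flip f"] f nf by auto
    have ne: "Y \<noteq> []" "Z \<noteq> []" using Y(2) Z(2) l by auto
    define a where "a = length Y"
    \<comment> \<open>From the base of \<open>B i\<close> to the base of \<open>B j\<close>; the middle crosses \<open>f\<close> just once.\<close>
    define \<tau> where "\<tau> = (rev_walk Y @ [f]) @ Z"
    have "nb_walk G (rev_walk (flip f # Y))" using Y(1) by (simp only: nb_walk_rev_walk)
    then have nb: "nb_walk G \<tau>"
      using Z(1) ne by (auto simp: \<tau>_def nb_walk_append nb_walk_Cons)
    have len: "length \<tau> = a + 1 + length Z" by (simp add: \<tau>_def a_def)
    have colI: "idx (vtx \<tau> r) = i" if "p \<le> r" "r \<le> a" for r
    proof -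
      have "vtx \<tau> r = vtx (rev_walk Y) r"
        using vtx_append1[of r "rev_walk Y" "[f] @ Z"] that(2) ne by (simp add: \<tau>_def a_def)
      also have "\<dots> = vtx Y (a - r)"
        using vtx_rev_walk[of G Y r] Y(1) ne that(2) by (simp add: nb_walk_Cons a_def)
      finally show ?thesis using Y(3)[of "a - r"] that idx[OF it] by (simp add: a_def)
    qed
    have colJ: "idx (vtx \<tau> r) = j" if "a < r" "r \<le> a + 1 + length Z - p" for r
    proof -
      have "vtx \<tau> r = vtx Z (r - (a + 1))"
        using vtx_append2[of G "rev_walk Y @ [f]" Z "r - (a + 1)"] nb ne that(1) by (simp add: \<tau>_def a_def)
      moreover have "r - (a + 1) \<le> length Z - p" using that by linarith
      ultimately show ?thesis using Z(3) idx[OF ij(2)] by simp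
    qed
    have al: "l \<le> a" using Y(2) by (simp add: a_def)
    define c where "c = a + 1 + length Z - l"
    have c: "c + l = a + 1 + length Z" "a < c" using Z(2) by (simp_all add: c_def)
    show ?thesis
    proof (rule adjacent_slides_window[OF nb, of 0 "a - p" c])
      show "h (window l \<tau> s) = i" if "s \<le> a - p" for s
      proof -
        have s: "s + p \<le> a" "s + l \<le> length \<tau>" using that al p Z(2) len by auto
        have "idx (vtx \<tau> (s + (l - p))) \<in> {i, j}"
        proof (cases "s + (l - p) \<le> a")
          case True
          then show ?thesis using colI p by simp
        next
          case False
          then show ?thesis using colJ[of "s + (l - p)"] s al p Z(2) by simp
        qed
        then show ?thesis using hwin[OF nb s(2)] colI[of "s + p"] s(1) ij(1) by auto
      qed
      show "h (window l \<tau> s) = j" if "a - p < s" "s \<le> c" for s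
      proof -
        have "s + l \<le> length \<tau>" using that(2) c len by simp
        moreover have "s + p \<le> a + 1 + length Z - p" "s + (l - p) \<le> a + 1 + length Z - p"
          using that(2) c p by linarith+
        ultimately show ?thesis using hwin[OF nb] colJ[of "s + p"] colJ[of "s + (l - p)"] that p by simp
      qed
      have "window l \<tau> 0 = window l (rev_walk Y) 0" using Y(2) by (simp add: window_def \<tau>_def)
      also have "\<dots> = rev_walk (window l Y (length Y - l))" using window_rev_walk[of 0 l Y] Y(2) by simp
      finally show "slides_to G l h i (b i) (window l \<tau> 0)" using slide_rev[OF it Y(4)] by simp
      have "window l \<tau> c = window l Z (length Z - l)"
        using Z(2) by (simp add: window_def \<tau>_def c_def a_def Suc_diff_le)
      then show "slides_to G l h j (b j) (window l \<tau> c)" using Z(4) by simp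
    qed (use c len in auto)
  qed
  have "clique_model (link_graph l G) {..<t} (\<lambda>i. walk_link ` {x. slides_to G l h i (b i) x})"
    by (rule clique_model_of_slides[OF G l]) (use hrev b adj in auto)
  then show ?thesis by blast
qed


section \<open>A branch set of small diameter: links pulled out of the rest of the graph\<close>

lemma clique_model_connected_Union:
  assumes model: "clique_model G I B"
  shows "connected_in G (\<Union>i\<in>I. B i)"
  unfolding connected_in_def
proof (intro ballI)
  let ?U = "\<Union>i\<in>I. B i"
  fix x y assume "x \<in> ?U" "y \<in> ?U"
  then obtain i j where ij: "i \<in> I" "x \<in> B i" "j \<in> I" "y \<in> B j" by blast
  have inner: "(adjacent_in G ?U)\<^sup>*\<^sup>* u v" if "k \<in> I" "u \<in> B k" "v \<in> B k" for k u v
  proof -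
    have "(adjacent_in G (B k))\<^sup>*\<^sup>* u v"
      using model that by (simp add: clique_model_def connected_in_def)
    then show ?thesis by (rule adjacent_in_rtranclp_mono) (use that(1) in blast)
  qed
  show "(adjacent_in G ?U)\<^sup>*\<^sup>* x y"
  proof (cases "i = j")
    case True
    then show ?thesis using inner ij by simp
  next
    case False
    obtain e u v where e: "e \<in> edges G" "u \<in> B i" "v \<in> B j" "ends G e = {u, v}"
      using clique_model_touch[OF model ij(1,3) False] .
    have "adjacent_in G ?U u v" using e ij(1,3) by (auto simp: adjacent_in_def)
    then show ?thesis
      using inner[OF ij(1,2) e(2)] inner[OF ij(3) e(3) ij(4)] by (meson rtranclp.rtrancl_into_rtrancl rtranclp_trans)
  qed
qed

text \<open>Let \<open>Y\<close> be the union of the branch sets other than \<open>X = B i0\<close>, and let \<open>f j\<close> be an edge from \<open>X\<close> to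
  \<open>B j\<close>. A link that lies in \<open>Y\<close> except for its end edge \<open>f j\<close> can be pulled through \<open>X\<close> until the same
  is true for \<open>f k\<close>; as \<open>X\<close> is small, it covers \<open>f j\<close> or \<open>f k\<close> all the way. So links are labelled by
  the edges \<open>f j\<close> that they contain. Links that run inside \<open>Y\<close> take the label \<open>i0\<close>, and their branch set
  replaces \<open>X\<close>.\<close>

lemma small_branch_set:
  fixes G :: "('v, 'e) mgraph"
  assumes G: "multigraph G" and l: "l \<ge> 1" and t: "t \<ge> 4" and model: "clique_model G {..<t::nat} B"
    and i0: "i0 < t"
    and small: "\<And>x y. x \<in> B i0 \<Longrightarrow> y \<in> B i0 \<Longrightarrow>
      \<exists>xs. nb_walk G xs \<and> inside (B i0) xs \<and> joins x xs y \<and> length xs < l"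
  shows "\<exists>B'. clique_model (link_graph l G) {..<t} B'"
proof -
  define I where "I = {..<t} - {i0}"
  define Y where "Y = (\<Union>i\<in>I. B i)"
  have modelI: "clique_model G I B" by (rule clique_model_mono[OF model]) (simp add: I_def)
  have I: "finite I" "3 \<le> card I" using i0 t by (simp_all add: I_def)
  have connY: "connected_in G Y" unfolding Y_def by (rule clique_model_connected_Union[OF modelI])
  have XY: "v \<notin> Y" if "v \<in> B i0" for v
  proof
    assume "v \<in> Y"
    then obtain j where "j \<in> I" "v \<in> B j" by (auto simp: Y_def)
    then show False using clique_model_disjoint[OF model, of i0 j v] that i0 by (simp add: I_def)
  qed

  \<comment> \<open>The other branch sets are at least three, hence contain arbitrarily long walks.\<close>
  obtain B' where B': "clique_model G I B'" "\<forall>i\<in>I. B' i \<subseteq> B i" "branching G (\<Union>i\<in>I. B' i)"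
    using clique_model_branching[OF G I modelI] by (elim exE conjE)
  have "(\<Union>i\<in>I. B' i) \<noteq> {}" using B'(1) I by (auto simp: clique_model_def)
  then obtain T where T: "length T = 3 * l" "nb_walk G T" "inside (\<Union>i\<in>I. B' i) T"
    using long_nb_walk[OF G B'(3)] by blast
  have TY: "inside Y T" by (rule inside_mono[OF T(3)]) (use B'(2) in \<open>auto simp: Y_def\<close>)
  have neT: "T \<noteq> []" using T(1) l by auto

  have "\<exists>d. d \<in> darts G \<and> src d \<in> B i0 \<and> tgt d \<in> B j" if "j \<in> I" for j
  proof -
    have j: "j \<in> {..<t}" "i0 \<noteq> j" using that by (auto simp: I_def)
    obtain d where "d \<in> darts G" "src d \<in> B i0" "tgt d \<in> B j"
      using dart_between[OF model _ j] i0 by blast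
    then show ?thesis by blast
  qed
  then obtain f where f: "\<And>j. j \<in> I \<Longrightarrow> f j \<in> darts G" "\<And>j. j \<in> I \<Longrightarrow> src (f j) \<in> B i0"
    "\<And>j. j \<in> I \<Longrightarrow> tgt (f j) \<in> B j"
    by metis
  have ends_eq: "{src d, tgt d} = {src (f j), tgt (f j)}"
    if "j \<in> I" "d \<in> darts G" "edge d = edge (f j)" for d j
    using f(1)[OF that(1)] that(2,3) by (simp add: darts_def)
  have fY: "tgt (f j) \<in> Y" "src (f j) \<notin> Y" if "j \<in> I" for j
    using f(2,3)[OF that] XY that by (auto simp: Y_def)
  have not_Y: "edge (f j) \<notin> edge ` set xs" if "j \<in> I" "nb_walk G xs" "inside Y xs" for j xs
  proof
    assume "edge (f j) \<in> edge ` set xs"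
    then obtain d where d: "d \<in> set xs" "edge d = edge (f j)" by auto
    then have "d \<in> darts G" "src d \<in> Y" "tgt d \<in> Y" using that by (auto simp: nb_walk_def inside_def)
    then show False using ends_eq[OF that(1) _ d(2)] fY[OF that(1)] by (auto simp: doubleton_eq_iff)
  qed
  have not_X: "edge (f j) \<notin> edge ` set xs" if "j \<in> I" "nb_walk G xs" "inside (B i0) xs" for j xs
  proof
    assume "edge (f j) \<in> edge ` set xs"
    then obtain d where d: "d \<in> set xs" "edge d = edge (f j)" by auto
    then have "d \<in> darts G" "src d \<in> B i0" "tgt d \<in> B i0" using that by (auto simp: nb_walk_def inside_def)
    then show False using ends_eq[OF that(1) _ d(2)] fY[OF that(1)] XY by (auto simp: doubleton_eq_iff)
  qed
  have f_inj: "j = k" if "j \<in> I" "k \<in> I" "edge (f j) = edge (f k)" for j k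
  proof -
    have "tgt (f j) = tgt (f k)"
      using ends_eq[OF that(2) f(1)[OF that(1)] that(3)] fY[OF that(1)] fY[OF that(2)]
      by (auto simp: doubleton_eq_iff)
    then show ?thesis using clique_model_disjoint[OF modelI that(1,2)] f(3)[OF that(1)] f(3)[OF that(2)] by simp
  qed

  define h where "h xs = (if \<exists>j\<in>I. edge (f j) \<in> edge ` set xs
    then LEAST j. j \<in> I \<and> edge (f j) \<in> edge ` set xs else i0)" for xs :: "('v, 'e) dart list"
  have hrev: "h (rev_walk xs) = h xs" for xs by (simp add: h_def)
  have hY: "h xs = i0" if "nb_walk G xs" "inside Y xs" for xs
    using not_Y[OF _ that] by (auto simp: h_def)
  have hf: "h xs = j" if "j \<in> I" "edge (f j) \<in> edge ` set xs"
    "\<And>k. k \<in> I \<Longrightarrow> edge (f k) \<in> edge ` set xs \<Longrightarrow> j \<le> k" for xs j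
    unfolding h_def using that by (auto intro!: Least_equality)

  have winT: "nb_walk G (window l T s) \<and> inside Y (window l T s)" for s
    using nb_walk_window[OF T(2)] inside_window[OF TY] by simp
  define b0 where "b0 = window l T l"
  have b0: "nb_walk G b0" "length b0 = l" "h b0 = i0"
    using winT[of l] hY T(1) by (simp_all add: b0_def)
  have slideT: "slides_to G l h i0 b0 (window l T s)" if "s \<le> 2 * l" for s
  proof (cases "s \<le> l")
    case True
    have "slides_to G l h i0 (window l T s) b0"
      unfolding b0_def using True T winT hY by (intro slides_to_window) auto
    then show ?thesis by (rule slides_to_sym)
  next
    case False
    then show ?thesis
      unfolding b0_def using that T winT hY by (intro slides_to_window) auto
  qed

  have "\<exists>Z. nb_walk G (f j # Z) \<and> l \<le> length Z \<and> inside Y Z \<and>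
      slides_to G l h i0 b0 (window l Z (length Z - l))" if j: "j \<in> I" for j
  proof -
    have mid: "vtx T k \<in> Y" if "l \<le> k" "k \<le> 2 * l" for k
      using inside_vtx[OF TY neT] that T(1) by simp
    obtain Z s where Z: "nb_walk G (f j # Z)" "length Z \<ge> l" "s \<le> l + l div 2"
      "window l Z (length Z - l) \<in> {window l T s, rev_walk (window l T s)}"
      "\<And>C. Y \<subseteq> C \<Longrightarrow> inside C T \<Longrightarrow> inside C Z"
      using approach_walk[OF connY T(2,1) l mid f(1)[OF j] fY(2)[OF j] fY(1)[OF j]] by metis
    have "slides_to G l h i0 b0 (window l T s)" using Z(3) by (intro slideT) simp
    then have "slides_to G l h i0 b0 (window l Z (length Z - l))"
      using Z(4) slides_to_rev[OF _ b0 hrev, of "window l T s"] by (elim insertE emptyE) simp_all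
    then show ?thesis using Z(1,2) Z(5)[OF order_refl TY] by (intro exI[of _ Z] conjI)
  qed
  then have "\<exists>Z. \<forall>j\<in>I. nb_walk G (f j # Z j) \<and> l \<le> length (Z j) \<and> inside Y (Z j) \<and>
      slides_to G l h i0 b0 (window l (Z j) (length (Z j) - l))"
    by (intro bchoice ballI)
  then obtain Z where Z: "\<And>j. j \<in> I \<Longrightarrow> nb_walk G (f j # Z j)" "\<And>j. j \<in> I \<Longrightarrow> l \<le> length (Z j)"
    "\<And>j. j \<in> I \<Longrightarrow> inside Y (Z j)" "\<And>j. j \<in> I \<Longrightarrow> slides_to G l h i0 b0 (window l (Z j) (length (Z j) - l))"
    by auto

  define b where "b j = (if j = i0 then b0 else f j # take (l - 1) (Z j))" for j
  have bI: "b j = f j # take (l - 1) (Z j)" "b j = window l (f j # Z j) 0" if "j \<in> I" for j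
    using that l by (auto simp: b_def I_def window_def take_Cons')
  have b_edge: "k = j" if "j \<in> I" "k \<in> I" "edge (f k) \<in> edge ` set (b j)" for j k
  proof -
    have "nb_walk G (take (l - 1) (Z j))" "inside Y (take (l - 1) (Z j))"
      using Z(1,3)[OF that(1)] by (simp_all add: nb_walk_Cons nb_walk_take inside_take)
    then have "edge (f k) = edge (f j)" using not_Y[OF that(2)] that(3) bI(1)[OF that(1)] by auto
    then show ?thesis using f_inj that by blast
  qed
  have b: "nb_walk G (b j)" "length (b j) = l" "h (b j) = j" if "j \<in> I" for j
  proof -
    show "nb_walk G (b j)" using nb_walk_window[OF Z(1)[OF that]] bI(2)[OF that] by simp
    show "length (b j) = l" using Z(2)[OF that] bI(1)[OF that] l by simp
    show "h (b j) = j" using b_edge[OF that] bI(1)[OF that] by (intro hf that) auto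
  qed
  have adj0: "adjacent_slides G l h b j i0" if j: "j \<in> I" for j
  proof -
    have l': "l \<le> length (Z j)" using Z(2)[OF j] .
    show ?thesis
    proof (rule adjacent_slides_window[OF Z(1)[OF j], of 0 0 "length (Z j) + 1 - l"])
      show "h (window l (f j # Z j) s) = j" if "s \<le> 0" for s
        using that b(3)[OF j] bI(2)[OF j] by simp
      show "h (window l (f j # Z j) s) = i0" if "0 < s" for s
      proof -
        have eq: "window l (f j # Z j) s = window l (Z j) (s - 1)" using that by (cases s) (simp_all add: window_def)
        have "nb_walk G (Z j)" using Z(1)[OF j] by (simp add: nb_walk_Cons)
        moreover have "inside Y (window l (Z j) (s - 1))"
          by (rule inside_window[OF Z(3)[OF j]])
        ultimately show ?thesis unfolding eq by (intro hY nb_walk_window)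
      qed
      show "slides_to G l h j (b j) (window l (f j # Z j) 0)" using bI(2)[OF j] by simp
      have "window l (f j # Z j) (length (Z j) + 1 - l) = window l (Z j) (length (Z j) - l)"
        using l' by (simp add: window_def Suc_diff_le)
      then show "slides_to G l h i0 (b i0) (window l (f j # Z j) (length (Z j) + 1 - l))"
        using Z(4)[OF j] by (simp add: b_def)
    qed (use l' in auto)
  qed
  have adj: "adjacent_slides G l h b j k" if jk: "j \<in> I" "k \<in> I" "j < k" for j k
  proof -
    obtain P where P: "nb_walk G P" "inside (B i0) P" "joins (src (f j)) P (src (f k))" "length P < l"
      using small[OF f(2)[OF jk(1)] f(2)[OF jk(2)]] by blast
    \<comment> \<open>The edge \<open>f j\<close> has index \<open>l - 1\<close> and \<open>f k\<close> has index \<open>l + length P < 2 * l\<close>, so that a window that no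
      longer contains \<open>f j\<close> contains \<open>f k\<close>. Windows containing both get the smaller label \<open>j\<close>.\<close>
    define \<tau> where "\<tau> = rev_walk (b j) @ P @ b k"
    have lenb: "length (b j) = l" "length (b k) = l" using b(2) jk by auto
    have neb: "b j \<noteq> []" "b k \<noteq> []" using lenb l by auto
    have ends_b: "last (rev_walk (b j)) = flip (f j)" "hd (b k) = f k"
      using bI(1) jk neb by (simp_all add: last_rev_walk)
    have len: "length \<tau> = 2 * l + length P" using lenb by (simp add: \<tau>_def)
    have Pe: "edge (f m) \<noteq> edge d" if "m \<in> I" "d \<in> set P" for m d
      using not_X[OF that(1) P(1,2)] that(2) by auto
    have "edge (f j) \<noteq> edge (f k)" using f_inj jk by blast
    then have "follows (flip (f j)) (hd (P @ b k))"
      using P(3) Pe[OF jk(1)] ends_b(2) by (auto simp: follows_def joins_def hd_append)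
    moreover have "nb_walk G (P @ b k)"
    proof -
      have "follows (last P) (f k)" if "P \<noteq> []"
        using P(3) that Pe[OF jk(2) last_in_set[OF that]] by (auto simp: follows_def joins_def)
      then show ?thesis using P(1) b(1)[OF jk(2)] ends_b(2) by (simp add: nb_walk_append)
    qed
    ultimately have nb: "nb_walk G \<tau>"
      unfolding \<tau>_def nb_walk_append[of G "rev_walk (b j)"] using b(1)[OF jk(1)] ends_b(1) by simp
    have only: "m = j \<or> m = k" if "m \<in> I" "edge (f m) \<in> edge ` set \<tau>" for m
    proof -
      have "edge ` set \<tau> = edge ` set (b j) \<union> edge ` set P \<union> edge ` set (b k)"
        by (simp add: \<tau>_def image_Un Un_assoc)
      then show ?thesis
        using that(2) not_X[OF that(1) P(1,2)] b_edge[OF jk(1) that(1)] b_edge[OF jk(2) that(1)] by blast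
    qed
    have sub: "set (window l \<tau> s) \<subseteq> set \<tau>" for s
      using set_take_subset[of l "drop s \<tau>"] set_drop_subset[of s \<tau>] by (auto simp: window_def)
    have atj: "\<tau> ! (l - 1) = flip (f j)"
      using ends_b(1) neb lenb l by (simp add: \<tau>_def nth_append last_conv_nth)
    have atk: "\<tau> ! (l + length P) = f k"
      using ends_b(2) neb lenb by (simp add: \<tau>_def nth_append hd_conv_nth)
    show ?thesis
    proof (rule adjacent_slides_window[OF nb, of 0 "l - 1" "l + length P"])
      show "h (window l \<tau> s) = j" if s: "s \<le> l - 1" for s
      proof (rule hf[OF jk(1)])
        have "\<tau> ! (l - 1) \<in> set (window l \<tau> s)"
          using s l len by (subst set_window) (auto intro!: imageI)
        then have "flip (f j) \<in> set (window l \<tau> s)" by (simp only: atj)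
        from imageI[OF this, of edge] show "edge (f j) \<in> edge ` set (window l \<tau> s)" by simp
        fix m assume "m \<in> I" "edge (f m) \<in> edge ` set (window l \<tau> s)"
        then have "m = j \<or> m = k" using only[of m] image_mono[OF sub, of edge s] by blast
        then show "j \<le> m" using jk(3) by auto
      qed
      show "h (window l \<tau> s) = k" if s: "l - 1 < s" "s \<le> l + length P" for s
      proof (rule hf[OF jk(2)])
        have "\<tau> ! (l + length P) \<in> set (window l \<tau> s)"
          using s l len P(4) by (subst set_window) (auto intro!: imageI)
        then have "f k \<in> set (window l \<tau> s)" by (simp only: atk)
        from imageI[OF this, of edge] show "edge (f k) \<in> edge ` set (window l \<tau> s)" by simp
        fix m assume m: "m \<in> I" "edge (f m) \<in> edge ` set (window l \<tau> s)"
        have "window l \<tau> s = window l (P @ b k) (s - l)"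
          using s lenb by (simp add: \<tau>_def window_def)
        then have "set (window l \<tau> s) \<subseteq> set P \<union> set (b k)"
          using set_take_subset[of l "drop (s - l) (P @ b k)"] set_drop_subset[of "s - l" "P @ b k"]
          by (auto simp: window_def)
        then have "edge (f m) \<in> edge ` set (b k)" using m(2) not_X[OF m(1) P(1,2)] by blast
        then show "k \<le> m" using b_edge[OF jk(2) m(1)] by simp
      qed
      have "window l \<tau> 0 = rev_walk (b j)" using lenb by (simp add: \<tau>_def window_def)
      then show "slides_to G l h j (b j) (window l \<tau> 0)"
        using slides_to_rev_walk[of G "b j" l h j] b[OF jk(1)] hrev by simp
      have "window l \<tau> (l + length P) = b k" using lenb by (simp add: \<tau>_def window_def)
      then show "slides_to G l h k (b k) (window l \<tau> (l + length P))" by simp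
    qed (use l len in auto)
  qed
  have "clique_model (link_graph l G) {..<t} (\<lambda>i. walk_link ` {x. slides_to G l h i (b i) x})"
  proof (rule clique_model_of_slides[OF G l])
    show "h (rev_walk xs) = h xs" for xs by (rule hrev)
    show "nb_walk G (b i) \<and> length (b i) = l \<and> h (b i) = i" if "i < t" for i
      using b[of i] b0 that by (cases "i = i0") (auto simp: I_def b_def)
    show "adjacent_slides G l h b i j \<or> adjacent_slides G l h b j i" if "i < j" "j < t" for i j
      using adj[of i j] adj0[of i] adj0[of j] that by (cases "i = i0"; cases "j = i0") (auto simp: I_def)
  qed
  then show ?thesis by blast
qed


section \<open>The Hadwiger number of a link graph\<close>

text \<open>With at least four branch sets, either one of them is small or all of them are large; in the latter
  case the model has to be shrunk first so that links can be moved beyond the ends of a branch set.\<close>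

lemma clique_model_link_graph:
  assumes G: "multigraph G" and l: "l \<ge> 1" and t: "t \<ge> 3" and model: "clique_model G {..<t::nat} B"
  shows "\<exists>B'. clique_model (link_graph l G) {..<t} B'"
proof (cases "t = 3")
  case True
  then show ?thesis using three_branch_sets[OF G l] model by simp
next
  case False
  have "3 \<le> card {..<t}" using t by simp
  then obtain B' where B': "clique_model G {..<t} B'" "branching G (\<Union>i<t. B' i)"
    using clique_model_branching[OF G _ _ model] by auto
  show ?thesis
  proof (cases "\<exists>i<t. \<forall>x\<in>B' i. \<forall>y\<in>B' i. \<exists>xs. nb_walk G xs \<and> inside (B' i) xs \<and> joins x xs y \<and> length xs < l")
    case True
    then obtain i where i: "i < t"
      "\<And>x y. x \<in> B' i \<Longrightarrow> y \<in> B' i \<Longrightarrow> \<exists>xs. nb_walk G xs \<and> inside (B' i) xs \<and> joins x xs y \<and> length xs < l"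
      by blast
    show ?thesis by (rule small_branch_set[OF G l _ B'(1) i]) (use t \<open>t \<noteq> 3\<close> in auto)
  next
    case False
    show ?thesis
      by (rule large_branch_sets[OF G l B']) (use False in \<open>meson not_le\<close>)
  qed
qed

theorem theorem1p3:
  fixes G :: "('v, 'e) mgraph" and l :: nat
  assumes "multigraph G" and "l \<ge> 1" and "edges (link_graph l G) \<noteq> {}"
  shows "hadwiger (link_graph l G) \<ge> max (hadwiger G) (degeneracy G)"
proof -
  let ?L = "link_graph l G"
  have L: "multigraph ?L" by (rule multigraph_link_graph[OF assms(1)])
  have le: "t \<le> hadwiger ?L" if "\<exists>B. clique_model ?L {..<t} B" for t
    using that clique_model_le_hadwiger[OF L] by blast
  obtain Q where "Q \<in> edges ?L" using assms(3) by blast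
  then have two: "2 \<le> hadwiger ?L" using le[OF clique_model_edge[OF L]] by blast
  have "hadwiger G \<le> hadwiger ?L"
  proof (cases "hadwiger G \<ge> 3")
    case True
    obtain B where "clique_model G {..<hadwiger G} B" using hadwiger_clique_model[OF assms(1)] by blast
    then show ?thesis by (rule le[OF clique_model_link_graph[OF assms(1,2) True]])
  qed (use two in simp)
  moreover have "degeneracy G \<le> hadwiger ?L"
  proof (cases "degeneracy G \<ge> 3")
    case True
    obtain a where "is_arc G (l + 1) a"
      using \<open>Q \<in> edges ?L\<close> by (auto simp: link_graph_def links_def)
    then have "verts G \<noteq> {}" by (auto simp: is_arc_def)
    then have "degeneracy G \<in> {min_degree H | H. subgraph H G \<and> verts H \<noteq> {}}"
      unfolding degeneracy_def by (intro Max_in degeneracy_set[OF assms(1)])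
    then obtain H where H: "subgraph H G" "verts H \<noteq> {}" "degeneracy G = min_degree H" by auto
    have "degeneracy G \<le> min_degree H" using H(3) by simp
    then show ?thesis by (rule le[OF min_degree_clique_model[OF assms(1,2) H(1,2) True]])
  qed (use two in simp)
  ultimately show ?thesis by simp
qed

end
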